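(* Consider episodic MDPs with $H$ stages, width $k$ and action set $\mathcal{A}$ of size $A$, with unknown transition probabilities and unknown reward distributions, in the fully bandit feedback model described in the context. There is an online learning algorithm (which knows $H$, $k$, $A$ and the number of episodes $T$) whose expected regret over $T$ episodes on every such MDP is $$O\left(H^2(Ak)^{H}\sqrt{H k A\, T \log T }\right).$$
   Context: An episodic MDP $(H,k,\mathcal{A},P,r)$ has states $(l,i)$ for levels $l\in[k]$ and stages $i\in[H]$; the start state is $(1,1)$. For $i\in[H-1]$, taking action $a\in\mathcal{A}$ at state $(l,i)$ moves to state $(s,i+1)$ with probability $p_i(s\mid l,a)$ (transitions only go between consecutive stages). Taking action $a$ at $(l,i)$ yields a random reward $R_{l,i}(a)\ge 0$ with mean $r_{l,i}(a)$; the total reward of any execution of the MDP lies in $[0,1]$. A deterministic policy is a matrix $\Pi=(\pi_{l,i})_{l\in[k],i\in[H]}$ of actions, executed by taking action $\pi_{l,i}$ whenever state $(l,i)$ is reached; its value $V(\Pi)$ is its expected total reward, and $\mathsf{Opt}$ is the maximum value over all policies. Learning setting: the transition probabilities and reward distributions are unknown, $H,k,A$ are known. In each of $T$ episodes $t=1,\dots,T$ the learner chooses a policy $\pi^t$ (possibly randomized, based on past observations), it is executed once, and the learner observes only the total (aggregate) reward of that episode — not the visited states nor the per-step rewards. The regret is $\mathcal{R}(T)=\sum_{t=1}^T(\mathsf{Opt}-V(\pi^t))$, and the expected regret is its expectation. *)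

theory Defs
  imports "HOL-Probability.Probability"
begin

(* Indexing conventions: levels l \<in> {0..<k}, stages i \<in> {0..<H},
   actions a \<in> {0..<A}; start state is (level 0, stage 0).
   p i l a  : distribution of the next level when action a is taken at (l,i)
   R l i a  : reward distribution (a probability measure on the reals)
   A deterministic policy is a matrix pol l i (action at state (l,i)). *)

type_synonym policy = "nat \<Rightarrow> nat \<Rightarrow> nat"

definition policies :: "nat \<Rightarrow> nat \<Rightarrow> nat \<Rightarrow> policy set" where
  "policies H k A = {pol. \<forall>l i. (l < k \<and> i < H \<longrightarrow> pol l i < A) \<and>
                                (\<not> (l < k \<and> i < H) \<longrightarrow> pol l i = 0)}"

definition mdp_kernels ::
  "nat \<Rightarrow> nat \<Rightarrow> nat \<Rightarrow> (nat \<Rightarrow> nat \<Rightarrow> nat \<Rightarrow> nat pmf) \<Rightarrow> (nat \<Rightarrow> nat \<Rightarrow> nat \<Rightarrow> real measure) \<Rightarrow> bool" where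
  "mdp_kernels H k A p R \<longleftrightarrow>
     (\<forall>i l a. i + 1 < H \<and> l < k \<and> a < A \<longrightarrow> set_pmf (p i l a) \<subseteq> {..<k}) \<and>
     (\<forall>l i a. l < k \<and> i < H \<and> a < A \<longrightarrow>
        prob_space (R l i a) \<and> sets (R l i a) = sets borel \<and> (AE x in R l i a. 0 \<le> x))"

text \<open>Distribution of the total reward collected during the last n stages
  (stages H-n, ..., H-1) when starting at level l at stage H-n and following pol.
  Reward at a step and the transition are drawn independently given state and action.\<close>
primrec reward_to_go ::
  "nat \<Rightarrow> (nat \<Rightarrow> nat \<Rightarrow> nat \<Rightarrow> nat pmf) \<Rightarrow> (nat \<Rightarrow> nat \<Rightarrow> nat \<Rightarrow> real measure) \<Rightarrow> policy
     \<Rightarrow> nat \<Rightarrow> nat \<Rightarrow> real measure" where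
  "reward_to_go H p R pol 0 l = return borel 0"
| "reward_to_go H p R pol (Suc n) l =
     (let i = H - Suc n; a = pol l i in
      convolution (R l i a)
        (bind (measure_pmf (p i l a)) (\<lambda>s. reward_to_go H p R pol n s)))"

definition episode_dist ::
  "nat \<Rightarrow> (nat \<Rightarrow> nat \<Rightarrow> nat \<Rightarrow> nat pmf) \<Rightarrow> (nat \<Rightarrow> nat \<Rightarrow> nat \<Rightarrow> real measure) \<Rightarrow> policy \<Rightarrow> real measure" where
  "episode_dist H p R pol = reward_to_go H p R pol H 0"

definition policy_value :: "nat \<Rightarrow> (nat \<Rightarrow> nat \<Rightarrow> nat \<Rightarrow> nat pmf) \<Rightarrow> (nat \<Rightarrow> nat \<Rightarrow> nat \<Rightarrow> real measure) \<Rightarrow> policy \<Rightarrow> real" where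
  "policy_value H p R pol = (\<integral>x. x \<partial>(episode_dist H p R pol))"

definition Opt :: "nat \<Rightarrow> nat \<Rightarrow> nat \<Rightarrow> (nat \<Rightarrow> nat \<Rightarrow> nat \<Rightarrow> nat pmf) \<Rightarrow> (nat \<Rightarrow> nat \<Rightarrow> nat \<Rightarrow> real measure) \<Rightarrow> real" where
  "Opt H k A p R = (SUP pol \<in> policies H k A. policy_value H p R pol)"

definition episodic_mdp ::
  "nat \<Rightarrow> nat \<Rightarrow> nat \<Rightarrow> (nat \<Rightarrow> nat \<Rightarrow> nat \<Rightarrow> nat pmf) \<Rightarrow> (nat \<Rightarrow> nat \<Rightarrow> nat \<Rightarrow> real measure) \<Rightarrow> bool" where
  "episodic_mdp H k A p R \<longleftrightarrow> mdp_kernels H k A p R \<and>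
     (\<forall>pol \<in> policies H k A. AE x in episode_dist H p R pol. 0 \<le> x \<and> x \<le> 1)"

text \<open>Histories: entry t of h is (policy played in episode t, observed total reward).
  At time t only entries < t are informative (the others hold a fixed default).\<close>
definition hist_space :: "(nat \<Rightarrow> policy \<times> real) measure" where
  "hist_space = PiM UNIV (\<lambda>_. count_space UNIV \<Otimes>\<^sub>M (borel :: real measure))"

primrec hist_dist ::
  "nat \<Rightarrow> (nat \<Rightarrow> nat \<Rightarrow> nat \<Rightarrow> nat pmf) \<Rightarrow> (nat \<Rightarrow> nat \<Rightarrow> nat \<Rightarrow> real measure)
    \<Rightarrow> (nat \<Rightarrow> (nat \<Rightarrow> policy \<times> real) \<Rightarrow> policy pmf) \<Rightarrow> nat \<Rightarrow> (nat \<Rightarrow> policy \<times> real) measure" where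
  "hist_dist H p R alg 0 = return hist_space (\<lambda>_. (\<lambda>_ _. 0, 0))"
| "hist_dist H p R alg (Suc t) =
     bind (hist_dist H p R alg t) (\<lambda>h.
       bind (measure_pmf (alg t h)) (\<lambda>pol.
         distr (episode_dist H p R pol) hist_space (\<lambda>r. h(t := (pol, r)))))"

definition valid_learner :: "nat \<Rightarrow> nat \<Rightarrow> nat \<Rightarrow> (nat \<Rightarrow> (nat \<Rightarrow> policy \<times> real) \<Rightarrow> policy pmf) \<Rightarrow> bool" where
  "valid_learner H k A alg \<longleftrightarrow>
     (\<forall>t h. set_pmf (alg t h) \<subseteq> policies H k A) \<and>
     (\<forall>t. (\<lambda>h. measure_pmf (alg t h)) \<in> hist_space \<rightarrow>\<^sub>M subprob_algebra (count_space UNIV))"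

definition expected_regret ::
  "nat \<Rightarrow> nat \<Rightarrow> nat \<Rightarrow> (nat \<Rightarrow> nat \<Rightarrow> nat \<Rightarrow> nat pmf) \<Rightarrow> (nat \<Rightarrow> nat \<Rightarrow> nat \<Rightarrow> real measure)
    \<Rightarrow> (nat \<Rightarrow> (nat \<Rightarrow> policy \<times> real) \<Rightarrow> policy pmf) \<Rightarrow> nat \<Rightarrow> real" where
  "expected_regret H k A p R alg T =
     (\<Sum>t<T. Opt H k A p R -
        (\<integral>h. (\<integral>pol. policy_value H p R pol \<partial>measure_pmf (alg t h)) \<partial>(hist_dist H p R alg t)))"

end

theory Submission
  imports Defs
begin

text \<open>
  The value of a policy is a linear function of the indicators of the \<open>(k A)\<^sup>H\<close> state-action
  trajectories with which it is consistent, so the problem is a stochastic linear bandit whose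
  arms are the \<open>A\<^bsup>k H\<^esup>\<close> policies, in dimension at most \<open>d = (k A)\<^sup>H\<close>. The learner is exponential
  weights with a linear estimator of all policy values, mixed with uniform exploration. The
  estimator uses the reproducing kernel of the span of the indicators in \<open>L\<^sup>2\<close> of the sampling
  distribution; its second moment is at most \<open>d\<close>, and uniform exploration bounds it pointwise
  because the span has an explicit product kernel for the uniform distribution, bounded by \<open>d\<close>.

  Rewards are rounded to a fine grid, so the learner's state lives in a countable set; this makes
  measurability of the learner immediate at the price of a negligible bias.
\<close>

section \<open>Reproducing kernels of finite-dimensional function spaces\<close>

text \<open>The quadratic bound on \<open>exp\<close> behind exponential weights needs \<eta> times
  every estimated value to be at most 1. With rewards in [0,1] this is a pointwise bound 1/\<eta> on
  the kernel, and exploration pays for it: if f(x)^2 is at most M0 times the uniform mean of f^2 for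
  every f in the span, mixing in the uniform policy at rate \<gamma> = \<eta> M0 suffices. The
  uniform kernel gives M0 = d^2 by Cauchy-Schwarz. The regret is then of order ln(number of
  policies)/\<eta> + T \<eta> d^2, the second-moment term T \<eta> d being dominated by exploration.
  As the logarithm is at most H k A, balancing yields d sqrt(H k A T), which is below the stated
  bound. The kernel is an arbitrary choice for each vector of estimates, so a measurable dependence
  on real rewards could not be read off from it; on a discrete countable space every choice is
  measurable. Rewards at unreachable states may have infinite mean. Linearity of the value is
  therefore derived in \<open>ennreal\<close> and moved to the reals only for whole
  episodes.\<close>

lemma ex_orthonormal_basis:
  fixes \<phi> :: "'j \<Rightarrow> 'a \<Rightarrow> real" and w :: "'a \<Rightarrow> real"
  assumes "finite X" "\<And>x. x \<in> X \<Longrightarrow> w x > 0" "finite J"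
  shows "\<exists>(m::nat) e. m \<le> card J
    \<and> (\<forall>a<m. \<forall>b<m. (\<Sum>x\<in>X. w x * e a x * e b x) = of_bool (a = b))
    \<and> (\<forall>a<m. \<exists>c. \<forall>x\<in>X. e a x = (\<Sum>j\<in>J. c j * \<phi> j x))
    \<and> (\<forall>j\<in>J. \<exists>c. \<forall>x\<in>X. \<phi> j x = (\<Sum>a<m. c a * e a x))"
  using assms(3)
proof (induction J)
  case empty
  show ?case by (intro exI[of _ 0]) auto
next
  case (insert j J)
  then obtain m e where m: "m \<le> card J"
    and on: "\<And>a b. a < m \<Longrightarrow> b < m \<Longrightarrow> (\<Sum>x\<in>X. w x * e a x * e b x) = of_bool (a = b)"
    and e: "\<And>a. a < m \<Longrightarrow> \<exists>c. \<forall>x\<in>X. e a x = (\<Sum>j\<in>J. c j * \<phi> j x)"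
    and \<phi>: "\<And>j. j \<in> J \<Longrightarrow> \<exists>c. \<forall>x\<in>X. \<phi> j x = (\<Sum>a<m. c a * e a x)"
    by blast
  have wn: "w x \<ge> 0" if "x \<in> X" for x using assms(2)[OF that] by simp
  have wrr: "w x * r * r \<ge> 0" if "x \<in> X" for x r
    using wn[OF that] by (simp add: mult.assoc)
  \<comment> \<open>Gram-Schmidt in the inner product weighted by \<open>w\<close>:
    \<open>ip\<close> holds the coordinates of the new function, \<open>r\<close> is its residual
    and \<open>n2\<close> the squared norm of the residual.\<close>
  define ip where "ip a = (\<Sum>x\<in>X. w x * \<phi> j x * e a x)" for a
  define r where "r x = \<phi> j x - (\<Sum>a<m. ip a * e a x)" for x
  define n2 where "n2 = (\<Sum>x\<in>X. w x * r x * r x)"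
  have orth: "(\<Sum>x\<in>X. w x * r x * e b x) = 0" if "b < m" for b
  proof -
    have "(\<Sum>x\<in>X. w x * r x * e b x) = ip b - (\<Sum>x\<in>X. \<Sum>a<m. ip a * (w x * e a x * e b x))"
      by (simp add: r_def ip_def algebra_simps sum_subtractf sum_distrib_left)
    also have "(\<Sum>x\<in>X. \<Sum>a<m. ip a * (w x * e a x * e b x))
        = (\<Sum>a<m. ip a * (\<Sum>x\<in>X. w x * e a x * e b x))"
      by (subst sum.swap) (simp add: sum_distrib_left)
    also have "\<dots> = (\<Sum>a<m. ip a * of_bool (a = b))"
      using on that by (intro sum.cong) auto
    also have "\<dots> = ip b" using that by (simp add: of_bool_def if_distrib cong: if_cong)
    finally show ?thesis by simp
  qed
  obtain ce where ce: "\<And>a x. a < m \<Longrightarrow> x \<in> X \<Longrightarrow> e a x = (\<Sum>j\<in>J. ce a j * \<phi> j x)"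
    using e by metis
  have rspan: "r x = (\<Sum>i\<in>insert j J. (if i = j then 1 else - (\<Sum>a<m. ip a * ce a i)) * \<phi> i x)"
    if "x \<in> X" for x
  proof -
    have "(\<Sum>a<m. ip a * e a x) = (\<Sum>a<m. \<Sum>i\<in>J. ip a * ce a i * \<phi> i x)"
      using that by (intro sum.cong) (auto simp: ce sum_distrib_left mult.assoc)
    also have "\<dots> = (\<Sum>i\<in>J. (\<Sum>a<m. ip a * ce a i) * \<phi> i x)"
      by (subst sum.swap) (simp add: sum_distrib_right)
    finally have 1: "(\<Sum>a<m. ip a * e a x) = (\<Sum>i\<in>J. (\<Sum>a<m. ip a * ce a i) * \<phi> i x)" .
    have 2: "(\<Sum>i\<in>J. (if i = j then 1 else - (\<Sum>a<m. ip a * ce a i)) * \<phi> i x)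
       = (\<Sum>i\<in>J. - ((\<Sum>a<m. ip a * ce a i) * \<phi> i x))"
      using insert(2) by (intro sum.cong) auto
    show ?thesis
      using insert(1,2) unfolding r_def 1 by (simp add: 2 sum_negf)
  qed
  have n2_nonneg: "n2 \<ge> 0"
    unfolding n2_def by (intro sum_nonneg wrr)
  have ext: "\<exists>c. \<forall>x\<in>X. e a x = (\<Sum>j\<in>insert j J. c j * \<phi> j x)" if "a < m" for a
    using insert(1,2) ce[OF that]
    by (intro exI[of _ "(ce a)(j := 0)"]) (auto intro!: sum.cong)
  show ?case
  \<comment> \<open>A vanishing residual adds no basis vector, so dependent functions are allowed
    and \<open>m\<close> may be smaller than \<open>card J\<close>. Positivity of \<open>w\<close>
    turns norm zero into zero on \<open>X\<close>.\<close>
  proof (cases "n2 = 0")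
    case True
    have "r x = 0" if "x \<in> X" for x
    proof -
      have "\<forall>x\<in>X. w x * r x * r x = 0"
        using True sum_nonneg_eq_0_iff[OF assms(1), of "\<lambda>x. w x * r x * r x"] wrr unfolding n2_def by simp
      thus ?thesis using that assms(2)[OF that] by auto
    qed
    hence "\<forall>x\<in>X. \<phi> j x = (\<Sum>a<m. ip a * e a x)" by (simp add: r_def)
    thus ?thesis using m on ext \<phi> insert(1,2)
      by (intro exI[of _ m] exI[of _ e]) auto
  next
    case False
    hence n2: "n2 > 0" using n2_nonneg by simp
    define s where "s = sqrt n2"
    have s: "s > 0" "s * s = n2" using n2 by (auto simp: s_def)
    define e' where "e' = e(m := (\<lambda>x. r x / s))"
    have e'[simp]: "a < m \<Longrightarrow> e' a = e a" "e' m x = r x / s" for a x by (auto simp: e'_def)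
    have o1: "(\<Sum>x\<in>X. w x * (r x / s) * e b x) = 0" if "b < m" for b
      using orth[OF that] by (simp flip: sum_divide_distrib)
    have o2: "(\<Sum>x\<in>X. w x * e b x * (r x / s)) = 0" if "b < m" for b
      using o1[OF that] by (simp add: mult_ac)
    have o3: "(\<Sum>x\<in>X. w x * (r x / s) * (r x / s)) = 1"
    proof -
      have "(\<Sum>x\<in>X. w x * (r x / s) * (r x / s)) = n2 / (s * s)"
        unfolding n2_def sum_divide_distrib by (simp add: divide_simps)
      thus ?thesis using s n2 by simp
    qed
    have "(\<Sum>x\<in>X. w x * e' a x * e' b x) = of_bool (a = b)" if "a < Suc m" "b < Suc m" for a b
      using that on o1 o2 o3 by (auto simp: less_Suc_eq)
    moreover have "\<exists>c. \<forall>x\<in>X. e' a x = (\<Sum>j\<in>insert j J. c j * \<phi> j x)" if "a < Suc m" for a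
    proof (cases "a = m")
      case True
      show ?thesis unfolding True e'
      proof (intro exI ballI)
        fix x assume "x \<in> X"
        show "r x / s = (\<Sum>i\<in>insert j J. (if i = j then 1 else - (\<Sum>a<m. ip a * ce a i)) / s * \<phi> i x)"
          unfolding rspan[OF \<open>x \<in> X\<close>] sum_divide_distrib by (intro sum.cong) auto
      qed
    qed (use ext that in auto)
    moreover have "\<exists>c. \<forall>x\<in>X. \<phi> i x = (\<Sum>a<Suc m. c a * e' a x)" if "i \<in> insert j J" for i
    proof (cases "i = j")
      case True
      show ?thesis unfolding True
        by (intro exI[of _ "ip(m := s)"]) (use s in \<open>simp add: r_def\<close>)
    next
      case False
      then obtain c where "\<forall>x\<in>X. \<phi> i x = (\<Sum>a<m. c a * e a x)" using \<phi> \<open>i \<in> insert j J\<close> by auto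
      thus ?thesis by (intro exI[of _ "c(m := 0)"]) simp
    qed
    ultimately show ?thesis using m insert(1,2)
      by (intro exI[of _ "Suc m"] exI[of _ e']) auto
  qed
qed

text \<open>The three clauses are what the estimator needs: bounded increments, unbiasedness on the
  span of \<phi> in L^2(\<open>w\<close>), and a second moment bounded by the dimension. Elements of
  the span are given by coefficient vectors \<open>c\<close>, as \<phi> need not be
  independent.\<close>

definition reproducing_kernel ::
  "'a set \<Rightarrow> 'j set \<Rightarrow> ('j \<Rightarrow> 'a \<Rightarrow> real) \<Rightarrow> real \<Rightarrow> ('a \<Rightarrow> real) \<Rightarrow> ('a \<Rightarrow> 'a \<Rightarrow> real) \<Rightarrow> bool" where
  "reproducing_kernel X J \<phi> M w K \<longleftrightarrow>
     (\<forall>x\<in>X. \<forall>y\<in>X. \<bar>K x y\<bar> \<le> M)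
     \<and> (\<forall>c. \<forall>x\<in>X. (\<Sum>y\<in>X. w y * K x y * (\<Sum>j\<in>J. c j * \<phi> j y)) = (\<Sum>j\<in>J. c j * \<phi> j x))
     \<and> (\<Sum>x\<in>X. \<Sum>y\<in>X. w x * w y * (K x y)\<^sup>2) \<le> card J"

text \<open>Take K(x,y) as the sum of e_a(x) e_a(y) over an orthonormal basis of the span. The
  squared norm of K(x,.) is K(x,x), and the total squared mass is the number of basis vectors, at
  most \<open>card J\<close>.\<close>

lemma ex_reproducing_kernel:
  fixes \<phi> :: "'j \<Rightarrow> 'a \<Rightarrow> real" and w :: "'a \<Rightarrow> real"
  assumes "finite X" "\<And>x. x \<in> X \<Longrightarrow> w x > 0" "finite J"
    and M: "M \<ge> 0"
    and lev: "\<And>c x. x \<in> X \<Longrightarrow> (\<Sum>j\<in>J. c j * \<phi> j x)\<^sup>2 \<le> M * (\<Sum>y\<in>X. w y * (\<Sum>j\<in>J. c j * \<phi> j y)\<^sup>2)"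
  shows "\<exists>K. reproducing_kernel X J \<phi> M w K"
proof -
  obtain m e where m: "m \<le> card J"
    and on: "\<And>a b. a < m \<Longrightarrow> b < m \<Longrightarrow> (\<Sum>x\<in>X. w x * e a x * e b x) = of_bool (a = b)"
    and e: "\<And>a. a < m \<Longrightarrow> \<exists>c. \<forall>x\<in>X. e a x = (\<Sum>j\<in>J. c j * \<phi> j x)"
    and \<phi>: "\<And>j. j \<in> J \<Longrightarrow> \<exists>c. \<forall>x\<in>X. \<phi> j x = (\<Sum>a<m. c a * e a x)"
    using ex_orthonormal_basis[where X = X and w = w and J = J and \<phi> = \<phi>, OF assms(1-3)] by blast
  define K where "K x y = (\<Sum>a<m. e a x * e a y)" for x y
  have Ke: "(\<Sum>y\<in>X. w y * K x y * e b y) = e b x" if "b < m" for x b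
  proof -
    have "(\<Sum>y\<in>X. w y * K x y * e b y) = (\<Sum>y\<in>X. \<Sum>a<m. e a x * (w y * e a y * e b y))"
      by (simp add: K_def sum_distrib_left sum_distrib_right mult_ac)
    also have "\<dots> = (\<Sum>a<m. e a x * (\<Sum>y\<in>X. w y * e a y * e b y))"
      by (subst sum.swap) (simp add: sum_distrib_left)
    also have "\<dots> = (\<Sum>a<m. e a x * of_bool (a = b))"
      using on that by (intro sum.cong) auto
    also have "\<dots> = e b x" using that by (simp add: of_bool_def if_distrib cong: if_cong)
    finally show ?thesis .
  qed
  have Kcomb: "(\<Sum>y\<in>X. w y * K x y * (\<Sum>a<m. c a * e a y)) = (\<Sum>a<m. c a * e a x)" for c x
  proof -
    have "(\<Sum>y\<in>X. w y * K x y * (\<Sum>a<m. c a * e a y)) = (\<Sum>y\<in>X. \<Sum>a<m. c a * (w y * K x y * e a y))"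
      by (simp add: sum_distrib_left mult_ac)
    also have "\<dots> = (\<Sum>a<m. c a * (\<Sum>y\<in>X. w y * K x y * e a y))"
      by (subst sum.swap) (simp add: sum_distrib_left)
    finally show ?thesis by (simp add: Ke)
  qed
  have K2: "(\<Sum>y\<in>X. w y * (K x y)\<^sup>2) = K x x" for x
    using Kcomb[of x "\<lambda>a. e a x"] unfolding K_def[symmetric] by (simp add: power2_eq_square mult.assoc)
  obtain ce where ce: "\<And>a x. a < m \<Longrightarrow> x \<in> X \<Longrightarrow> e a x = (\<Sum>j\<in>J. ce a j * \<phi> j x)"
    using e by metis
  obtain cp where cp: "\<And>j x. j \<in> J \<Longrightarrow> x \<in> X \<Longrightarrow> \<phi> j x = (\<Sum>a<m. cp j a * e a x)"
    using \<phi> by metis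
  have Kspan: "K x y = (\<Sum>j\<in>J. (\<Sum>a<m. e a x * ce a j) * \<phi> j y)" if "y \<in> X" for x y
  proof -
    have "K x y = (\<Sum>a<m. \<Sum>j\<in>J. e a x * ce a j * \<phi> j y)"
      unfolding K_def using that by (intro sum.cong) (auto simp: ce sum_distrib_left mult.assoc)
    thus ?thesis by (subst (asm) sum.swap) (simp add: sum_distrib_right)
  qed
  \<comment> \<open>K(x,.) lies in the span, so the leverage hypothesis applied to it at
    \<open>x\<close> reads K(x,x)^2 \<le> M K(x,x).\<close>
  have diag: "K x x \<le> M" if "x \<in> X" for x
  proof -
    have "(K x x)\<^sup>2 \<le> M * (\<Sum>y\<in>X. w y * (K x y)\<^sup>2)"
      using lev[OF that, of "\<lambda>j. \<Sum>a<m. e a x * ce a j"] that by (simp add: Kspan)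
    hence le: "K x x * K x x \<le> M * K x x" unfolding K2 by (simp add: power2_eq_square)
    have nn: "K x x \<ge> 0" unfolding K_def by (intro sum_nonneg) auto
    show ?thesis using le nn M by (cases "K x x = 0") auto
  qed
  have abs_le: "\<bar>K x y\<bar> \<le> M" if "x \<in> X" "y \<in> X" for x y
  proof -
    have "\<bar>K x y\<bar> \<le> (\<Sum>a<m. \<bar>e a x * e a y\<bar>)" unfolding K_def by (rule sum_abs)
    also have "\<dots> \<le> (\<Sum>a<m. (e a x * e a x + e a y * e a y) / 2)"
    proof (intro sum_mono)
      fix a
      have "0 \<le> (\<bar>e a x\<bar> - \<bar>e a y\<bar>)\<^sup>2" by simp
      thus "\<bar>e a x * e a y\<bar> \<le> (e a x * e a x + e a y * e a y) / 2"
        by (simp add: power2_diff abs_mult) (simp add: power2_eq_square)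
    qed
    also have "\<dots> = (K x x + K y y) / 2"
      by (simp add: K_def sum.distrib flip: sum_divide_distrib)
    also have "\<dots> \<le> M" using diag[OF that(1)] diag[OF that(2)] by simp
    finally show ?thesis .
  qed
  have repr: "(\<Sum>y\<in>X. w y * K x y * (\<Sum>j\<in>J. c j * \<phi> j y)) = (\<Sum>j\<in>J. c j * \<phi> j x)"
    if x: "x \<in> X" for c x
  proof -
    have *: "(\<Sum>j\<in>J. c j * \<phi> j y) = (\<Sum>a<m. (\<Sum>j\<in>J. c j * cp j a) * e a y)" if "y \<in> X" for y
    proof -
      have "(\<Sum>j\<in>J. c j * \<phi> j y) = (\<Sum>j\<in>J. \<Sum>a<m. c j * cp j a * e a y)"
        using that by (intro sum.cong) (auto simp: cp sum_distrib_left mult.assoc)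
      thus ?thesis by (subst (asm) sum.swap) (simp add: sum_distrib_right)
    qed
    show ?thesis using x by (simp add: * Kcomb cong: sum.cong)
  qed
  have "(\<Sum>x\<in>X. \<Sum>y\<in>X. w x * w y * (K x y)\<^sup>2) = (\<Sum>x\<in>X. w x * K x x)"
    by (simp add: K2[symmetric] sum_distrib_left mult.assoc)
  also have "\<dots> = (\<Sum>a<m. \<Sum>x\<in>X. w x * e a x * e a x)"
    by (subst sum.swap) (simp add: K_def sum_distrib_left mult.assoc)
  also have "\<dots> = m" using on by simp
  also have "\<dots> \<le> card J" using m by simp
  finally have "(\<Sum>x\<in>X. \<Sum>y\<in>X. w x * w y * (K x y)\<^sup>2) \<le> card J" .
  thus ?thesis using abs_le repr unfolding reproducing_kernel_def by blast
qed

section \<open>Exponential weights for linear bandits\<close>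

text \<open>For negative \<open>x\<close>, invert the quadratic Taylor lower bound of
  \<open>exp (- x)\<close>.\<close>

lemma exp_le_quadratic:
  fixes x :: real
  assumes "x \<le> 1"
  shows "exp x \<le> 1 + x + x\<^sup>2"
proof (cases "x \<ge> 0")
  case True
  thus ?thesis using exp_bound[of x] assms by simp
next
  case False
  define y where "y = - x"
  have y: "y > 0" using False by (simp add: y_def)
  have "1 + y + y\<^sup>2 / 2 \<le> exp y"
    using exp_lower_Taylor_quadratic[of y] y by simp
  moreover have "1 + y + y\<^sup>2 / 2 > 0" using y by (intro add_pos_pos) auto
  ultimately have "exp x \<le> inverse (1 + y + y\<^sup>2 / 2)"
    using le_imp_inverse_le[of "1 + y + y\<^sup>2 / 2" "exp y"] by (simp add: y_def exp_minus)
  also have "\<dots> \<le> 1 - y + y\<^sup>2"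
  proof -
    have "(1 - y + y\<^sup>2) * (1 + y + y\<^sup>2 / 2) = 1 + (y^2 + y^3 + y^4) / 2"
      by (simp add: field_simps power2_eq_square power3_eq_cube power4_eq_xxxx)
    also have "\<dots> \<ge> 1" using y by simp
    finally show ?thesis
      using \<open>1 + y + y\<^sup>2 / 2 > 0\<close> by (simp add: inverse_eq_divide pos_divide_le_eq)
  qed
  finally show ?thesis by (simp add: y_def)
qed

text \<open>\<open>M0\<close> is the leverage of the span under the uniform distribution. The
  equation \<open>\<eta> * M0 = \<gamma>\<close> makes the leverage under the mixed distribution at
  most 1/\<eta>. Rewards are integers counted in units of \<open>\<epsilon>\<close>.\<close>

locale exp2 =
  fixes X :: "'a set" and J :: "'j set" and \<phi> :: "'j \<Rightarrow> 'a \<Rightarrow> real"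
    and M0 \<eta> \<gamma> \<epsilon> :: real
  assumes finX: "finite X" and neX: "X \<noteq> {}" and finJ: "finite J"
    and \<eta>: "\<eta> > 0" and \<gamma>: "0 < \<gamma>" "\<gamma> \<le> 1/2" and M0: "\<eta> * M0 = \<gamma>"
    and leverage: "\<And>c x. x \<in> X \<Longrightarrow>
      (\<Sum>j\<in>J. c j * \<phi> j x)\<^sup>2 \<le> M0 * ((\<Sum>y\<in>X. (\<Sum>j\<in>J. c j * \<phi> j y)\<^sup>2) / card X)"
begin

definition W :: "('a \<Rightarrow> real) \<Rightarrow> real" where "W S = (\<Sum>x\<in>X. exp (\<eta> * S x))"

definition q :: "('a \<Rightarrow> real) \<Rightarrow> 'a \<Rightarrow> real" where "q S x = exp (\<eta> * S x) / W S"

definition prob :: "('a \<Rightarrow> real) \<Rightarrow> 'a \<Rightarrow> real" where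
  "prob S x = (1 - \<gamma>) * q S x + \<gamma> / card X"

text \<open>The kernel is taken in L^2 of the very distribution from which the next arm is drawn;
  this makes the estimator \<open>est\<close> unbiased for linear values.\<close>

definition kernel :: "('a \<Rightarrow> real) \<Rightarrow> 'a \<Rightarrow> 'a \<Rightarrow> real" where
  "kernel S = (SOME K. reproducing_kernel X J \<phi> (1 / \<eta>) (prob S) K)"

text \<open>Cumulative estimated rewards of all arms, latest observation at the head. Playing
  \<open>y\<close> with reward \<open>v\<close> adds \<open>kernel S x y * v\<close> to each arm
  \<open>x\<close>, where \<open>S\<close> are the estimates before that observation; averaging over
  \<open>y\<close> gives the reproducing identity.\<close>

primrec est :: "('a \<times> int) list \<Rightarrow> 'a \<Rightarrow> real" where
  "est [] = (\<lambda>_. 0)"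
| "est (o' # L) = (\<lambda>x. est L x + kernel (est L) x (fst o') * (\<epsilon> * snd o'))"

definition play :: "('a \<times> int) list \<Rightarrow> 'a pmf" where
  "play L = embed_pmf (\<lambda>x. if x \<in> X then prob (est L) x else 0)"

lemma card_pos: "card X > 0" using finX neX by (simp add: card_gt_0_iff)

lemma W_pos: "W S > 0" unfolding W_def using finX neX by (intro sum_pos) auto

lemma q_pos: "q S x > 0" using W_pos by (simp add: q_def)

lemma sum_q: "(\<Sum>x\<in>X. q S x) = 1"
  using W_pos[of S] by (simp add: q_def W_def flip: sum_divide_distrib)

lemma prob_pos: "prob S x > 0"
  unfolding prob_def using q_pos[of S x] \<gamma> card_pos by (intro add_pos_pos) auto

lemma sum_prob: "(\<Sum>x\<in>X. prob S x) = 1"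
  using sum_q[of S] card_pos by (simp add: prob_def sum.distrib flip: sum_distrib_left)

text \<open>Uses \<gamma> \<le> 1/2. It charges the second moment under the exponential weights to
  the sampling distribution, where the kernel controls it.\<close>

lemma q_le_prob: "q S x \<le> 2 * prob S x"
proof -
  have "q S x \<le> 2 * (1 - \<gamma>) * q S x" using \<gamma> q_pos[of S x] by (simp add: mult_le_cancel_right1)
  also have "\<dots> \<le> 2 * prob S x" using \<gamma> card_pos by (simp add: prob_def algebra_simps)
  finally show ?thesis .
qed

text \<open>The uniform component gives every arm weight at least \<gamma> / \<open>card X\<close>,
  so squared norms under \<open>prob S\<close> are at least \<gamma> times the uniform ones, and M0
  / \<gamma> = 1 / \<eta>.\<close>

lemma reproducing_kernel_kernel: "reproducing_kernel X J \<phi> (1 / \<eta>) (prob S) (kernel S)"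
proof -
  have "\<exists>K. reproducing_kernel X J \<phi> (1 / \<eta>) (prob S) K"
  proof (rule ex_reproducing_kernel[OF finX prob_pos finJ])
    fix c x assume "x \<in> X"
    let ?f = "\<lambda>x. \<Sum>j\<in>J. c j * \<phi> j x"
    have "(?f x)\<^sup>2 \<le> M0 * ((\<Sum>y\<in>X. (?f y)\<^sup>2) / card X)" using leverage[OF \<open>x \<in> X\<close>] .
    also have "\<dots> = 1 / \<eta> * (\<Sum>y\<in>X. \<gamma> / card X * (?f y)\<^sup>2)"
      unfolding sum_distrib_left[symmetric] using \<eta> by (simp add: M0[symmetric])
    also have "\<dots> \<le> 1 / \<eta> * (\<Sum>y\<in>X. prob S y * (?f y)\<^sup>2)"
      using \<eta> \<gamma> by (intro mult_left_mono sum_mono mult_right_mono)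
        (auto simp: prob_def intro!: mult_nonneg_nonneg less_imp_le[OF q_pos])
    finally show "(?f x)\<^sup>2 \<le> 1 / \<eta> * (\<Sum>y\<in>X. prob S y * (?f y)\<^sup>2)" .
  qed (use \<eta> in auto)
  thus ?thesis unfolding kernel_def by (rule someI_ex)
qed

lemmas abs_kernel_le = reproducing_kernel_kernel[unfolded reproducing_kernel_def, THEN conjunct1, rule_format]
  and kernel_repr = reproducing_kernel_kernel[unfolded reproducing_kernel_def, THEN conjunct2, THEN conjunct1, rule_format]
  and kernel_square = reproducing_kernel_kernel[unfolded reproducing_kernel_def, THEN conjunct2, THEN conjunct2]

lemma pmf_play: "pmf (play L) x = (if x \<in> X then prob (est L) x else 0)"
  unfolding play_def
proof (rule pmf_embed_pmf)
  show "0 \<le> (if x \<in> X then prob (est L) x else 0)" for x using prob_pos less_imp_le by auto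
  have "(\<integral>\<^sup>+x. ennreal (if x \<in> X then prob (est L) x else 0) \<partial>count_space UNIV)
      = (\<Sum>x\<in>X. ennreal (prob (est L) x))"
    using finX by (subst nn_integral_count_space'[of X]) (auto intro!: sum.cong)
  also have "\<dots> = 1" by (subst sum_ennreal) (auto simp: sum_prob less_imp_le[OF prob_pos])
  finally show "(\<integral>\<^sup>+x. ennreal (if x \<in> X then prob (est L) x else 0) \<partial>count_space UNIV) = 1" .
qed

lemma set_play: "set_pmf (play L) = X"
  by (auto simp: set_pmf_eq pmf_play less_imp_neq[OF prob_pos, symmetric])

text \<open>The ratio of successive potentials is the \<open>q S\<close>-mean of exp(\<eta> v). The
  quadratic bound on \<open>exp\<close>, followed by 1 + a \<le> exp a, leaves only first and second
  moments.\<close>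

lemma ln_W_step:
  assumes "\<And>x. x \<in> X \<Longrightarrow> \<eta> * v x \<le> 1"
  shows "ln (W (\<lambda>x. S x + v x)) \<le> ln (W S) + \<eta> * (\<Sum>x\<in>X. q S x * v x) + \<eta>\<^sup>2 * (\<Sum>x\<in>X. q S x * (v x)\<^sup>2)"
proof -
  let ?a = "\<eta> * (\<Sum>x\<in>X. q S x * v x) + \<eta>\<^sup>2 * (\<Sum>x\<in>X. q S x * (v x)\<^sup>2)"
  have "W (\<lambda>x. S x + v x) = W S * (\<Sum>x\<in>X. q S x * exp (\<eta> * v x))"
    using W_pos[of S] by (simp add: W_def[of "\<lambda>x. S x + v x"] q_def sum_distrib_left algebra_simps exp_add)
  also have "\<dots> \<le> W S * (\<Sum>x\<in>X. q S x * (1 + \<eta> * v x + (\<eta> * v x)\<^sup>2))"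
    using assms W_pos[of S]
    by (intro mult_left_mono sum_mono exp_le_quadratic) (auto intro: less_imp_le q_pos)
  also have "(\<Sum>x\<in>X. q S x * (1 + \<eta> * v x + (\<eta> * v x)\<^sup>2)) = 1 + ?a"
    using sum_q[of S]
    by (simp add: distrib_left sum.distrib sum_distrib_left mult_ac power_mult_distrib)
  also have "W S * (1 + ?a) \<le> W S * exp ?a"
    using W_pos[of S] exp_ge_add_one_self[of ?a] by (intro mult_left_mono) auto
  finally have "ln (W (\<lambda>x. S x + v x)) \<le> ln (W S * exp ?a)"
    using W_pos[of S] W_pos[of "\<lambda>x. S x + v x"] by (subst ln_le_cancel_iff) auto
  thus ?thesis using W_pos[of S] by (simp add: ln_mult)
qed

end

section \<open>Regret analysis on a fixed linear bandit instance\<close>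

text \<open>\<open>Z x\<close> is the rounded reward in units of \<epsilon>, \<open>V x\<close> the
  exact mean. Rounding spoils linearity of the means, so the span condition is put on
  \<open>V\<close> and the mean of \<open>Z\<close> is tied to it up to \<epsilon>.\<close>

locale exp2_run = exp2 X J \<phi> M0 \<eta> \<gamma> \<epsilon>
  for X :: "'a set" and J :: "'j set" and \<phi> M0 \<eta> \<gamma> \<epsilon> +
  fixes V :: "'a \<Rightarrow> real" and Z :: "'a \<Rightarrow> int pmf" and m :: int
  assumes V_span: "\<exists>c. \<forall>x\<in>X. V x = (\<Sum>j\<in>J. c j * \<phi> j x)"
    and V01: "\<And>x. x \<in> X \<Longrightarrow> V x \<in> {0..1}"
    and \<epsilon>: "\<epsilon> > 0" "\<epsilon> * m \<le> 1"
    and Z_range: "\<And>x. x \<in> X \<Longrightarrow> set_pmf (Z x) \<subseteq> {0..m}"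
    and Z_mean: "\<And>x. x \<in> X \<Longrightarrow> \<bar>\<epsilon> * measure_pmf.expectation (Z x) real_of_int - V x\<bar> \<le> \<epsilon>"
begin

primrec run :: "nat \<Rightarrow> ('a \<times> int) list pmf" where
  "run 0 = return_pmf []"
| "run (Suc t) = bind_pmf (run t) (\<lambda>L. bind_pmf (play L) (\<lambda>x. map_pmf (\<lambda>z. (x, z) # L) (Z x)))"

lemma finite_Z: "x \<in> X \<Longrightarrow> finite (set_pmf (Z x))"
  using Z_range finite_subset by blast

lemma finite_run: "finite (set_pmf (run t))"
  by (induction t) (auto simp: set_play finX finite_Z)

definition mean_value :: "('a \<times> int) list \<Rightarrow> real" where
  "mean_value L = (\<Sum>x\<in>X. prob (est L) x * V x)"

text \<open>Transition operator of the chain \<open>run\<close>: the conditional expectation of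
  \<open>g\<close> after one more round.\<close>

definition step :: "(('a \<times> int) list \<Rightarrow> real) \<Rightarrow> ('a \<times> int) list \<Rightarrow> real" where
  "step g L = (\<Sum>x\<in>X. prob (est L) x * (\<Sum>z\<in>{0..m}. pmf (Z x) z * g ((x, z) # L)))"

lemma expectation_run_Suc:
  "measure_pmf.expectation (run (Suc t)) g = measure_pmf.expectation (run t) (step g)"
proof -
  have *: "measure_pmf.expectation (bind_pmf (play L) (\<lambda>x. map_pmf (\<lambda>z. (x, z) # L) (Z x))) g = step g L" for L
  proof -
    have "measure_pmf.expectation (map_pmf (\<lambda>z. (x, z) # L) (Z x)) g
        = (\<Sum>z\<in>{0..m}. pmf (Z x) z * g ((x, z) # L))" if "x \<in> X" for x
      using Z_range[OF that] by (subst integral_map_pmf, subst integral_measure_pmf[of "{0..m}"]) auto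
    thus ?thesis
      by (subst pmf_expectation_bind[of X]) (auto simp: finX finite_Z set_play step_def pmf_play)
  qed
  show ?thesis
    unfolding run.simps
    by (subst pmf_expectation_bind[of "set_pmf (run t)"])
       (auto simp: finite_run set_play finX finite_Z * integral_measure_pmf[of "set_pmf (run t)"])
qed

lemma sum_Z: "x \<in> X \<Longrightarrow> (\<Sum>z\<in>{0..m}. pmf (Z x) z) = 1"
  using Z_range by (intro sum_pmf_eq_1) auto

definition mu :: "'a \<Rightarrow> real" where "mu x = (\<Sum>z\<in>{0..m}. pmf (Z x) z * (\<epsilon> * z))"

lemma mu:
  assumes "x \<in> X"
  shows "\<bar>mu x - V x\<bar> \<le> \<epsilon>"
  using Z_mean[OF assms] Z_range[OF assms]
  by (subst (asm) integral_measure_pmf_real[of "{0..m}"]) (auto simp: mu_def sum_distrib_left mult_ac)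

lemma \<epsilon>z: "z \<in> {0..m} \<Longrightarrow> 0 \<le> \<epsilon> * z \<and> \<epsilon> * z \<le> 1"
  using \<epsilon> mult_left_mono[of "real_of_int z" m \<epsilon>, OF _ less_imp_le[OF \<epsilon>(1)]]
    order.trans[of "\<epsilon> * z" "\<epsilon> * m" 1] by simp

text \<open>The kernel reproduces \<open>V\<close> exactly; the rounding error \<epsilon> is
  amplified by at most the kernel bound 1/\<eta>.\<close>

lemma bias:
  assumes "x \<in> X"
  shows "\<bar>(\<Sum>y\<in>X. prob S y * (kernel S x y * mu y)) - V x\<bar> \<le> \<epsilon> / \<eta>"
proof -
  obtain c where c: "\<And>x. x \<in> X \<Longrightarrow> V x = (\<Sum>j\<in>J. c j * \<phi> j x)" using V_span by blast
  have "V x = (\<Sum>y\<in>X. prob S y * kernel S x y * V y)"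
    using kernel_repr[OF assms, of S c] assms by (simp add: c)
  hence "\<bar>(\<Sum>y\<in>X. prob S y * (kernel S x y * mu y)) - V x\<bar>
      = \<bar>\<Sum>y\<in>X. prob S y * kernel S x y * (mu y - V y)\<bar>"
    by (simp add: algebra_simps sum_subtractf)
  also have "\<dots> \<le> (\<Sum>y\<in>X. \<bar>prob S y * kernel S x y * (mu y - V y)\<bar>)" by (rule sum_abs)
  also have "\<dots> \<le> (\<Sum>y\<in>X. prob S y * (1 / \<eta>) * \<epsilon>)"
    unfolding abs_mult using \<eta>
    by (intro sum_mono mult_mono abs_kernel_le[OF assms] mu) (auto simp: less_imp_le[OF prob_pos])
  also have "\<dots> = \<epsilon> / \<eta>" unfolding sum_distrib_right[symmetric] by (simp add: sum_prob)
  finally show ?thesis .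
qed

lemma step_est:
  assumes "x \<in> X"
  shows "step (\<lambda>L. est L x) L \<ge> est L x + V x - \<epsilon> / \<eta>"
proof -
  have "step (\<lambda>L. est L x) L = (\<Sum>y\<in>X. prob (est L) y * (est L x + kernel (est L) x y * mu y))"
    unfolding step_def
  proof (intro sum.cong refl arg_cong2[of _ _ _ _ "(*)"])
    fix y assume "y \<in> X"
    have "kernel (est L) x y * mu y = (\<Sum>z\<in>{0..m}. pmf (Z y) z * (kernel (est L) x y * (\<epsilon> * z)))"
      unfolding mu_def sum_distrib_left by (simp add: mult_ac)
    thus "(\<Sum>z\<in>{0..m}. pmf (Z y) z * est ((y, z) # L) x) = est L x + kernel (est L) x y * mu y"
      using sum_Z[OF \<open>y \<in> X\<close>] by (simp add: distrib_left sum.distrib flip: sum_distrib_right)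
  qed
  also have "\<dots> = est L x + (\<Sum>y\<in>X. prob (est L) y * (kernel (est L) x y * mu y))"
    by (simp add: distrib_left sum.distrib sum_prob flip: sum_distrib_right)
  finally show ?thesis using bias[OF assms, of "est L"] by linarith
qed

text \<open>Averages the potential step over the played arm. First order: near-unbiasedness gives
  the \<open>q\<close>-mean of \<open>V\<close>, which exceeds the mean under \<open>prob\<close> by
  at most \<gamma> because \<open>V\<close> \<le> 1. Second order: rewards are at most 1, and
  \<open>q\<close> \<le> 2 \<open>prob\<close> bounds the term by twice the total squared mass of
  the kernel.\<close>

lemma step_ln_W:
  "step (\<lambda>L. ln (W (est L))) L \<le> ln (W (est L)) + \<eta> * (mean_value L + \<gamma> + \<epsilon> / \<eta>) + 2 * \<eta>\<^sup>2 * card J"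
proof -
  let ?S = "est L"
  let ?K = "kernel ?S" and ?p = "prob ?S" and ?q = "q ?S"
  have "step (\<lambda>L. ln (W (est L))) L \<le> (\<Sum>y\<in>X. ?p y * (\<Sum>z\<in>{0..m}. pmf (Z y) z *
     (ln (W ?S) + \<eta> * (\<Sum>x\<in>X. ?q x * (?K x y * (\<epsilon> * z))) + \<eta>\<^sup>2 * (\<Sum>x\<in>X. ?q x * (?K x y)\<^sup>2))))"
    unfolding step_def
  proof (intro sum_mono mult_left_mono less_imp_le[OF prob_pos] pmf_nonneg)
    fix y z assume yz: "y \<in> X" "z \<in> {0..m}"
    have "\<eta> * (?K x y * (\<epsilon> * z)) \<le> 1" if "x \<in> X" for x
    proof -
      have "?K x y * (\<epsilon> * z) \<le> \<bar>?K x y\<bar> * 1" using \<epsilon>z[OF yz(2)]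
        by (intro mult_mono) auto
      also have "\<dots> \<le> 1 / \<eta>" using abs_kernel_le[OF that yz(1)] by simp
      finally show ?thesis using \<eta> by (simp add: field_simps)
    qed
    note ln_W_step[of "\<lambda>x. ?K x y * (\<epsilon> * z)", OF this, of ?S]
    hence A: "ln (W (est ((y, z) # L))) \<le> ln (W ?S) + \<eta> * (\<Sum>x\<in>X. ?q x * (?K x y * (\<epsilon> * z)))
        + \<eta>\<^sup>2 * (\<Sum>x\<in>X. ?q x * (?K x y * (\<epsilon> * z))\<^sup>2)" by simp
    have "(\<Sum>x\<in>X. ?q x * (?K x y * (\<epsilon> * z))\<^sup>2) \<le> (\<Sum>x\<in>X. ?q x * (?K x y)\<^sup>2)"
      using \<epsilon>z[OF yz(2)]
      by (intro sum_mono mult_left_mono less_imp_le[OF q_pos])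
         (simp add: power_mult_distrib[of "kernel _ _ _"] mult_left_le power_le_one)
    from mult_left_mono[OF this, of "\<eta>\<^sup>2"] A
    show "ln (W (est ((y, z) # L))) \<le> ln (W ?S) + \<eta> * (\<Sum>x\<in>X. ?q x * (?K x y * (\<epsilon> * z)))
        + \<eta>\<^sup>2 * (\<Sum>x\<in>X. ?q x * (?K x y)\<^sup>2)" by simp
  qed
  also have "\<dots> = (\<Sum>y\<in>X. ?p y * (ln (W ?S) + \<eta> * (\<Sum>x\<in>X. ?q x * (?K x y * mu y)) + \<eta>\<^sup>2 * (\<Sum>x\<in>X. ?q x * (?K x y)\<^sup>2)))"
  proof (intro sum.cong refl arg_cong2[of _ _ _ _ "(*)"])
    fix y assume "y \<in> X"
    have "(\<Sum>x\<in>X. ?q x * (?K x y * mu y)) = (\<Sum>z\<in>{0..m}. pmf (Z y) z * (\<Sum>x\<in>X. ?q x * (?K x y * (\<epsilon> * z))))"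
      unfolding mu_def sum_distrib_left by (subst sum.swap) (simp add: mult_ac)
    thus "(\<Sum>z\<in>{0..m}. pmf (Z y) z *
     (ln (W ?S) + \<eta> * (\<Sum>x\<in>X. ?q x * (?K x y * (\<epsilon> * z))) + \<eta>\<^sup>2 * (\<Sum>x\<in>X. ?q x * (?K x y)\<^sup>2)))
      = ln (W ?S) + \<eta> * (\<Sum>x\<in>X. ?q x * (?K x y * mu y)) + \<eta>\<^sup>2 * (\<Sum>x\<in>X. ?q x * (?K x y)\<^sup>2)"
      using sum_Z[OF \<open>y \<in> X\<close>]
      by (simp add: distrib_left sum.distrib mult.left_commute[of _ \<eta>] flip: sum_distrib_right sum_distrib_left[of \<eta>])
  qed
  also have "\<dots> = ln (W ?S) + \<eta> * (\<Sum>x\<in>X. ?q x * (\<Sum>y\<in>X. ?p y * (?K x y * mu y)))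
      + \<eta>\<^sup>2 * (\<Sum>x\<in>X. \<Sum>y\<in>X. ?q x * ?p y * (?K x y)\<^sup>2)"
  proof -
    have 1: "(\<Sum>y\<in>X. ?p y * (\<eta> * (\<Sum>x\<in>X. ?q x * (?K x y * mu y))))
        = \<eta> * (\<Sum>x\<in>X. ?q x * (\<Sum>y\<in>X. ?p y * (?K x y * mu y)))"
      unfolding sum_distrib_left by (subst sum.swap) (simp add: mult_ac)
    have 2: "(\<Sum>y\<in>X. ?p y * (\<eta>\<^sup>2 * (\<Sum>x\<in>X. ?q x * (?K x y)\<^sup>2)))
        = \<eta>\<^sup>2 * (\<Sum>x\<in>X. \<Sum>y\<in>X. ?q x * ?p y * (?K x y)\<^sup>2)"
      unfolding sum_distrib_left by (subst sum.swap) (simp add: mult_ac)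
    show ?thesis by (simp add: distrib_left sum.distrib sum_prob 1 2 flip: sum_distrib_right)
  qed
  also have "\<dots> \<le> ln (W ?S) + \<eta> * (mean_value L + \<gamma> + \<epsilon> / \<eta>) + \<eta>\<^sup>2 * (2 * real (card J))"
  proof (intro add_mono mult_left_mono order.refl)
    have "(\<Sum>x\<in>X. ?q x * (\<Sum>y\<in>X. ?p y * (?K x y * mu y))) \<le> (\<Sum>x\<in>X. ?q x * (V x + \<epsilon> / \<eta>))"
      using bias[of _ ?S]
      by (intro sum_mono mult_left_mono less_imp_le[OF q_pos]) (simp add: abs_diff_le_iff)
    also have "\<dots> = (\<Sum>x\<in>X. ?q x * V x) + \<epsilon> / \<eta>"
      by (simp add: distrib_left sum.distrib sum_q flip: sum_distrib_right sum_divide_distrib)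
    also have "(\<Sum>x\<in>X. ?q x * V x) \<le> mean_value L + \<gamma>"
    proof -
      have "(\<Sum>x\<in>X. ?q x * V x) \<le> (\<Sum>x\<in>X. ?q x * 1)"
        using V01 by (intro sum_mono mult_left_mono less_imp_le[OF q_pos]) auto
      hence le1: "(\<Sum>x\<in>X. ?q x * V x) \<le> 1" by (simp add: sum_q)
      have "(1 - \<gamma>) * (\<Sum>x\<in>X. ?q x * V x) \<le> mean_value L"
        unfolding mean_value_def sum_distrib_left
        using V01 \<gamma> by (intro sum_mono) (auto simp: prob_def algebra_simps)
      moreover have "\<gamma> * (\<Sum>x\<in>X. ?q x * V x) \<le> \<gamma>" using le1 \<gamma> by (simp add: mult_left_le)
      ultimately show ?thesis by (simp add: algebra_simps)
    qed
    finally show "(\<Sum>x\<in>X. ?q x * (\<Sum>y\<in>X. ?p y * (?K x y * mu y))) \<le> mean_value L + \<gamma> + \<epsilon> / \<eta>" by simp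
    have "(\<Sum>x\<in>X. \<Sum>y\<in>X. ?q x * ?p y * (?K x y)\<^sup>2) \<le> (\<Sum>x\<in>X. \<Sum>y\<in>X. 2 * (?p x * ?p y * (?K x y)\<^sup>2))"
      using q_le_prob[of ?S] by (intro sum_mono) (auto simp flip: mult.assoc intro!: mult_right_mono less_imp_le[OF prob_pos])
    also have "\<dots> = 2 * (\<Sum>x\<in>X. \<Sum>y\<in>X. ?p x * ?p y * (?K x y)\<^sup>2)" by (simp add: sum_distrib_left)
    also have "\<dots> \<le> 2 * real (card J)" using kernel_square[of ?S] by simp
    finally show "(\<Sum>x\<in>X. \<Sum>y\<in>X. ?q x * ?p y * (?K x y)\<^sup>2) \<le> 2 * real (card J)" .
  qed (use \<eta> in auto)
  finally show ?thesis by (simp add: algebra_simps)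
qed

lemma integrable_run: "integrable (measure_pmf (run t)) (g :: _ \<Rightarrow> real)"
  by (rule integrable_measure_pmf_finite[OF finite_run])

text \<open>The expected log-potential dominates \<eta> times the estimate of the comparator
  \<open>x\<close>, and per round it grows by \<eta> times the learner's mean value plus errors. The
  bias \<epsilon>/\<eta> enters once on each side, whence the factor 2; \<open>ln (card X)\<close>
  is the initial log-potential.\<close>

lemma regret_bound:
  assumes "x \<in> X"
  shows "(\<Sum>t<T. V x - measure_pmf.expectation (run t) mean_value)
    \<le> ln (card X) / \<eta> + T * (\<gamma> + 2 * (\<epsilon> / \<eta>) + 2 * \<eta> * card J)"
proof -
  let ?E = "\<lambda>t. measure_pmf.expectation (run t)"
  have lower: "?E t (\<lambda>L. est L x) \<ge> t * (V x - \<epsilon> / \<eta>)" for t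
  proof (induction t)
    case (Suc t)
    have "?E t (\<lambda>L. est L x + (V x - \<epsilon> / \<eta>)) \<le> ?E t (step (\<lambda>L. est L x))"
      using step_est[OF assms] by (intro integral_mono integrable_run) (simp add: algebra_simps)
    thus ?case using Suc unfolding expectation_run_Suc by (simp add: integrable_run algebra_simps)
  qed simp
  have upper: "?E t (\<lambda>L. ln (W (est L))) \<le> ln (card X) + \<eta> * (\<Sum>s<t. ?E s mean_value)
      + t * (\<eta> * (\<gamma> + \<epsilon> / \<eta>) + 2 * \<eta>\<^sup>2 * card J)" for t
  proof (induction t)
    case 0
    show ?case by (simp add: W_def)
  next
    case (Suc t)
    have "?E t (step (\<lambda>L. ln (W (est L)))) \<le>
        ?E t (\<lambda>L. ln (W (est L)) + \<eta> * (mean_value L + \<gamma> + \<epsilon> / \<eta>) + 2 * \<eta>\<^sup>2 * card J)"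
      using step_ln_W by (intro integral_mono integrable_run)
    also have "\<dots> = ?E t (\<lambda>L. ln (W (est L))) + \<eta> * (?E t mean_value + \<gamma> + \<epsilon> / \<eta>) + 2 * \<eta>\<^sup>2 * card J"
      by (simp add: integrable_run)
    finally show ?case using Suc unfolding expectation_run_Suc by (simp add: algebra_simps)
  qed
  have "\<eta> * est L x \<le> ln (W (est L))" for L
  proof -
    have "exp (\<eta> * est L x) \<le> W (est L)"
      unfolding W_def using assms finX by (intro member_le_sum) auto
    thus ?thesis using W_pos[of "est L"] by (simp add: ln_ge_iff)
  qed
  hence "?E T (\<lambda>L. \<eta> * est L x) \<le> ?E T (\<lambda>L. ln (W (est L)))"
    by (intro integral_mono integrable_run)
  moreover have "\<eta> * (T * (V x - \<epsilon> / \<eta>)) \<le> ?E T (\<lambda>L. \<eta> * est L x)"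
    using mult_left_mono[OF lower[of T], of \<eta>] \<eta> by simp
  ultimately have "\<eta> * (T * (V x - \<epsilon> / \<eta>)) \<le> ln (card X) + \<eta> * (\<Sum>s<T. ?E s mean_value)
      + T * (\<eta> * (\<gamma> + \<epsilon> / \<eta>) + 2 * \<eta>\<^sup>2 * card J)" using upper[of T] by linarith
  hence "\<eta> * (T * V x - (\<Sum>s<T. ?E s mean_value)) \<le> \<eta> * (ln (card X) / \<eta> + T * (\<gamma> + 2 * (\<epsilon> / \<eta>) + 2 * \<eta> * card J))"
    using \<eta> by (simp add: algebra_simps power2_eq_square)
  thus ?thesis using \<eta> by (simp add: sum_subtractf)
qed

end

section \<open>Trajectories and the uniform policy\<close>

text \<open>Start level and transitions are not respected: the set is a full product, so a single
  stage can be split off freely.\<close>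

definition trajs :: "nat set \<Rightarrow> nat \<Rightarrow> nat \<Rightarrow> (nat \<Rightarrow> nat \<times> nat) set" where
  "trajs I k A = I \<rightarrow>\<^sub>E ({..<k} \<times> {..<A})"

text \<open>A 0/1 indicator in product form so that it factors over stages; polymorphic because the
  coefficients in front of it are first \<open>ennreal\<close> and later
  \<open>real\<close>.\<close>

definition consistent :: "nat set \<Rightarrow> (nat \<Rightarrow> nat \<times> nat) \<Rightarrow> policy \<Rightarrow> 'a::comm_semiring_1" where
  "consistent I \<tau> pol = (\<Prod>i\<in>I. of_bool (pol (fst (\<tau> i)) i = snd (\<tau> i)))"

abbreviation rows :: "nat \<Rightarrow> nat \<Rightarrow> (nat \<Rightarrow> nat) set" where
  "rows k A \<equiv> {..<k} \<rightarrow>\<^sub>E {..<A}"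

lemma finite_trajs: "finite I \<Longrightarrow> finite (trajs I k A)"
  unfolding trajs_def by (intro finite_PiE) auto

lemma card_trajs: "finite I \<Longrightarrow> card (trajs I k A) = (k * A) ^ card I"
  unfolding trajs_def by (simp add: card_funcsetE card_cartesian_product)

text \<open>Exhibits the uniform policy as a product distribution: independent rows per stage,
  independent actions per level. The default 0 of a policy corresponds to \<open>undefined\<close>
  in the extensional functions.\<close>

lemma bij_betw_policies:
  "bij_betw (\<lambda>w l i. if l < k \<and> i < H then w i l else 0) ({..<H} \<rightarrow>\<^sub>E rows k A) (policies H k A)"
proof (rule bij_betwI[where g = "\<lambda>pol. \<lambda>i\<in>{..<H}. \<lambda>l\<in>{..<k}. pol l i"])
  show "(\<lambda>w l i. if l < k \<and> i < H then w i l else 0) \<in> ({..<H} \<rightarrow>\<^sub>E rows k A) \<rightarrow> policies H k A"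
    by (fastforce simp: policies_def PiE_iff)
  show "(\<lambda>pol. \<lambda>i\<in>{..<H}. \<lambda>l\<in>{..<k}. pol l i) \<in> policies H k A \<rightarrow> ({..<H} \<rightarrow>\<^sub>E rows k A)"
    by (auto simp: policies_def)
  show "(\<lambda>i\<in>{..<H}. \<lambda>l\<in>{..<k}. if l < k \<and> i < H then w i l else 0) = w"
    if "w \<in> {..<H} \<rightarrow>\<^sub>E rows k A" for w
    using that by (fastforce simp: fun_eq_iff PiE_iff extensional_def restrict_def)
  show "(\<lambda>l i. if l < k \<and> i < H then (\<lambda>i\<in>{..<H}. \<lambda>l\<in>{..<k}. pol l i) i l else 0) = pol"
    if "pol \<in> policies H k A" for pol
    using that by (auto simp: fun_eq_iff policies_def)
qed

lemma finite_policies: "finite (policies H k A)"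
  using bij_betw_finite[OF bij_betw_policies[of k H A]] by (auto intro!: finite_PiE)

lemma card_policies: "card (policies H k A) = (A ^ k) ^ H"
  using bij_betw_same_card[OF bij_betw_policies[of k H A]] by (simp add: card_funcsetE)

lemma sum_policies_prod:
  fixes g :: "nat \<Rightarrow> (nat \<Rightarrow> nat) \<Rightarrow> real"
  shows "(\<Sum>pol\<in>policies H k A. \<Prod>i<H. g i (\<lambda>l\<in>{..<k}. pol l i)) = (\<Prod>i<H. \<Sum>r\<in>rows k A. g i r)"
proof -
  have "(\<Sum>pol\<in>policies H k A. \<Prod>i<H. g i (\<lambda>l\<in>{..<k}. pol l i))
      = (\<Sum>w\<in>{..<H} \<rightarrow>\<^sub>E rows k A. \<Prod>i<H. g i (\<lambda>l\<in>{..<k}. if l < k \<and> i < H then w i l else 0))"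
    by (rule sum.reindex_bij_betw[OF bij_betw_policies, symmetric])
  also have "\<dots> = (\<Sum>w\<in>{..<H} \<rightarrow>\<^sub>E rows k A. \<Prod>i<H. g i (w i))"
  proof (intro sum.cong prod.cong refl arg_cong2[of _ _ _ _ g])
    fix w i assume "w \<in> {..<H} \<rightarrow>\<^sub>E rows k A" "i \<in> {..<H}"
    thus "(\<lambda>l\<in>{..<k}. if l < k \<and> i < H then w i l else 0) = w i"
      by (fastforce simp: fun_eq_iff PiE_iff extensional_def restrict_def)
  qed
  also have "\<dots> = (\<Prod>i<H. \<Sum>r\<in>rows k A. g i r)"
    by (subst prod_sum_PiE) (auto intro!: finite_PiE)
  finally show ?thesis .
qed

lemma sum_rows_prod:
  fixes g :: "nat \<Rightarrow> nat \<Rightarrow> real"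
  shows "(\<Sum>r\<in>rows k A. \<Prod>l<k. g l (r l)) = (\<Prod>l<k. \<Sum>a<A. g l a)"
  by (subst prod_sum_PiE) auto

section \<open>Product kernel for the uniform distribution on policies\<close>

text \<open>Reproducing kernel, under the uniform row, of the sums of functions of single
  coordinates: 1 belongs to the constants, and \<open>real A * of_bool (r l = r' l) - 1\<close> to
  the mean-zero functions of coordinate \<open>l\<close>. These spaces are mutually
  orthogonal.\<close>

definition row_kernel :: "nat \<Rightarrow> nat \<Rightarrow> (nat \<Rightarrow> nat) \<Rightarrow> (nat \<Rightarrow> nat) \<Rightarrow> real" where
  "row_kernel k A r r' = 1 + (\<Sum>l<k. real A * of_bool (r l = r' l) - 1)"

text \<open>Coordinates of a uniform row are independent, so every summand with index other than
  \<open>l\<close> averages to zero against a function of coordinate \<open>l\<close>. The constant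
  and the summand \<open>l\<close> together reproduce the indicator.\<close>

lemma row_kernel_reproducing:
  assumes "l < k" "a < A" and r: "\<And>l. l < k \<Longrightarrow> r l < A"
  shows "(\<Sum>r'\<in>rows k A. row_kernel k A r r' * of_bool (r' l = a)) = real (A ^ k) * of_bool (r l = a)"
proof -
  let ?N = "\<Sum>r'\<in>rows k A. of_bool (r' l = a) :: real"
  have N: "?N = (\<Prod>j<k. if j = l then 1 else real A)"
  proof -
    have "?N = (\<Sum>r'\<in>rows k A. \<Prod>j<k. if j = l then of_bool (r' j = a) else 1)"
      using assms by (intro sum.cong) (auto simp: prod.delta)
    also have "\<dots> = (\<Prod>j<k. \<Sum>x<A. if j = l then of_bool (x = a) else 1)"
      by (rule sum_rows_prod)
    also have "\<dots> = (\<Prod>j<k. if j = l then 1 else real A)"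
      using assms by (intro prod.cong) (auto simp: of_bool_def)
    finally show ?thesis .
  qed
  have "A * ?N = (\<Prod>j<k. if j = l then real A else 1) * (\<Prod>j<k. if j = l then 1 else real A)"
    using assms by (simp add: N prod.delta)
  also have "\<dots> = A ^ k" by (subst prod.distrib[symmetric]) (simp add: if_distrib cong: if_cong)
  finally have AN: "A * ?N = A ^ k" .
  have off: "(\<Sum>r'\<in>rows k A. (real A * of_bool (r j = r' j) - 1) * of_bool (r' l = a)) = 0"
    if "j < k" "j \<noteq> l" for j
  proof -
    have "(\<Sum>r'\<in>rows k A. real A * of_bool (r j = r' j) * of_bool (r' l = a))
        = (\<Sum>r'\<in>rows k A. \<Prod>i<k. (if i = j then real A * of_bool (r i = r' i) else 1) *
                                 (if i = l then of_bool (r' i = a) else 1))"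
      using assms that by (intro sum.cong refl, subst prod.distrib) (simp add: prod.delta)
    also have "\<dots> = (\<Prod>i<k. \<Sum>x<A. (if i = j then real A * of_bool (r i = x) else 1) *
                                 (if i = l then of_bool (x = a) else 1))"
      by (rule sum_rows_prod)
    also have "\<dots> = (\<Prod>i<k. if i = l then 1 else real A)"
    proof (intro prod.cong refl)
      fix i assume "i \<in> {..<k}"
      hence *: "(\<Sum>x<A. of_bool (r i = x) :: real) = 1" using assms by (simp add: of_bool_def)
      show "(\<Sum>x<A. (if i = j then real A * of_bool (r i = x) else 1) * (if i = l then of_bool (x = a) else 1))
          = (if i = l then 1 else real A)"
        using assms that * by (cases "i = j"; cases "i = l") (auto simp flip: sum_distrib_left)
    qed
    finally show ?thesis by (simp add: left_diff_distrib sum_subtractf N)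
  qed
  have "(\<Sum>r'\<in>rows k A. row_kernel k A r r' * of_bool (r' l = a))
      = ?N + (\<Sum>j<k. \<Sum>r'\<in>rows k A. (real A * of_bool (r j = r' j) - 1) * of_bool (r' l = a))"
    unfolding row_kernel_def by (subst sum.swap) (simp add: distrib_right sum.distrib sum_distrib_right)
  also have "(\<Sum>j<k. \<Sum>r'\<in>rows k A. (real A * of_bool (r j = r' j) - 1) * of_bool (r' l = a))
     = (\<Sum>r'\<in>rows k A. (real A * of_bool (r l = r' l) - 1) * of_bool (r' l = a))"
    using assms(1) off by (subst sum.remove[of _ l]) auto
  also have "\<dots> = (real A * of_bool (r l = a) - 1) * ?N"
    unfolding sum_distrib_left by (intro sum.cong) auto
  also have "?N + \<dots> = of_bool (r l = a) * (A * ?N)" by (simp add: algebra_simps)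
  finally show ?thesis by (simp add: AN)
qed

lemma abs_row_kernel_le:
  assumes "k \<ge> 1" "A \<ge> 1"
  shows "\<bar>row_kernel k A r r'\<bar> \<le> k * A"
proof -
  let ?S = "\<Sum>l<k. real A * of_bool (r l = r' l) - 1"
  have "?S \<le> (\<Sum>l<k. real A - 1)" by (intro sum_mono) auto
  hence "?S \<le> real k * real A - real k" by (simp add: algebra_simps)
  moreover have "?S \<ge> (\<Sum>l<k. - 1)" by (intro sum_mono) auto
  hence "?S \<ge> - real k" by simp
  moreover have "real k * 1 \<le> real k * real A" using assms by (intro mult_left_mono) auto
  moreover have "real k \<ge> 1" using assms by simp
  ultimately have "1 + ?S \<le> real k * real A" "- (1 + ?S) \<le> real k * real A" by linarith+
  thus ?thesis by (simp only: row_kernel_def abs_le_iff of_nat_mult)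
qed

text \<open>Kernels multiply over independent stages, matching the trajectory indicators, which are
  products of one row indicator per stage.\<close>

definition policy_kernel :: "nat \<Rightarrow> nat \<Rightarrow> nat \<Rightarrow> policy \<Rightarrow> policy \<Rightarrow> real" where
  "policy_kernel H k A pol pol' = (\<Prod>i<H. row_kernel k A (\<lambda>l. pol l i) (\<lambda>l. pol' l i))"

lemma policy_kernel_reproducing:
  assumes "pol \<in> policies H k A" "\<tau> \<in> trajs {..<H} k A"
  shows "(\<Sum>pol'\<in>policies H k A. policy_kernel H k A pol pol' * consistent {..<H} \<tau> pol')
    = real (card (policies H k A)) * consistent {..<H} \<tau> pol"
proof -
  have \<tau>: "fst (\<tau> i) < k" "snd (\<tau> i) < A" if "i < H" for i
    using that assms(2) by (fastforce simp: trajs_def PiE_iff mem_Times_iff)+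
  have rk: "row_kernel k A r (\<lambda>l\<in>{..<k}. r' l) = row_kernel k A r r'" for r r'
    unfolding row_kernel_def by simp
  have "(\<Sum>pol'\<in>policies H k A. policy_kernel H k A pol pol' * consistent {..<H} \<tau> pol')
      = (\<Sum>pol'\<in>policies H k A. \<Prod>i<H. (\<lambda>i r. row_kernel k A (\<lambda>l. pol l i) r * of_bool (r (fst (\<tau> i)) = snd (\<tau> i))) i (\<lambda>l\<in>{..<k}. pol' l i))"
    unfolding policy_kernel_def consistent_def prod.distrib[symmetric]
    using \<tau> by (intro sum.cong prod.cong) (auto simp: rk)
  also have "\<dots> = (\<Prod>i<H. \<Sum>r\<in>rows k A. row_kernel k A (\<lambda>l. pol l i) r * of_bool (r (fst (\<tau> i)) = snd (\<tau> i)))"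
    by (rule sum_policies_prod)
  also have "\<dots> = (\<Prod>i<H. real (A ^ k) * of_bool (pol (fst (\<tau> i)) i = snd (\<tau> i)))"
    using assms(1) \<tau> by (intro prod.cong refl row_kernel_reproducing) (auto simp: policies_def)
  finally show ?thesis by (simp add: prod.distrib card_policies consistent_def)
qed

lemma policies_nonempty: "A \<ge> 1 \<Longrightarrow> policies H k A \<noteq> {}"
  by (auto simp: policies_def intro!: exI[of _ "\<lambda>_ _. 0"])

text \<open>The kernel expresses \<open>f pol\<close> as a uniform average of kernel times
  \<open>f\<close>; Cauchy-Schwarz with the pointwise kernel bound \<open>real (k * A) ^ H\<close>
  gives the squared constant.\<close>

lemma policy_leverage:
  fixes c :: "(nat \<Rightarrow> nat \<times> nat) \<Rightarrow> real"
  assumes "k \<ge> 1" "A \<ge> 1" "pol \<in> policies H k A"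
  defines "f \<equiv> \<lambda>pol. \<Sum>\<tau>\<in>trajs {..<H} k A. c \<tau> * consistent {..<H} \<tau> pol"
  shows "(f pol)\<^sup>2 \<le> (real (k * A) ^ H)\<^sup>2 * ((\<Sum>pol'\<in>policies H k A. (f pol')\<^sup>2) / card (policies H k A))"
proof -
  let ?P = "policies H k A"
  let ?N = "real (card ?P)"
  let ?K = "policy_kernel H k A pol"
  have N: "?N > 0" using finite_policies policies_nonempty[OF assms(2)] by (simp add: card_gt_0_iff)
  have "(\<Sum>pol'\<in>?P. ?K pol' * f pol') = (\<Sum>\<tau>\<in>trajs {..<H} k A. c \<tau> * (\<Sum>pol'\<in>?P. ?K pol' * consistent {..<H} \<tau> pol'))"
    unfolding f_def sum_distrib_left by (subst sum.swap) (simp add: mult_ac)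
  also have "\<dots> = ?N * f pol"
    unfolding f_def sum_distrib_left[of ?N]
    by (intro sum.cong refl) (simp add: policy_kernel_reproducing[OF assms(3)])
  finally have "(?N * f pol)\<^sup>2 = (\<Sum>pol'\<in>?P. ?K pol' * f pol')\<^sup>2" by simp
  also have "\<dots> \<le> (\<Sum>pol'\<in>?P. (?K pol')\<^sup>2) * (\<Sum>pol'\<in>?P. (f pol')\<^sup>2)"
    by (rule Cauchy_Schwarz_ineq_sum)
  also have "\<dots> \<le> (\<Sum>pol'\<in>?P. (real (k * A) ^ H)\<^sup>2) * (\<Sum>pol'\<in>?P. (f pol')\<^sup>2)"
  proof (intro mult_right_mono sum_mono sum_nonneg)
    fix pol'
    have "\<bar>?K pol'\<bar> \<le> (\<Prod>i<H. real (k * A))"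
      unfolding policy_kernel_def abs_prod using abs_row_kernel_le[OF assms(1,2)]
      by (intro prod_mono) auto
    thus "(?K pol')\<^sup>2 \<le> (real (k * A) ^ H)\<^sup>2" by (simp add: abs_le_square_iff[symmetric] del: of_nat_mult)
  qed auto
  finally have "?N * ?N * (f pol)\<^sup>2 \<le> ?N * (real (k * A) ^ H)\<^sup>2 * (\<Sum>pol'\<in>?P. (f pol')\<^sup>2)"
    by (simp add: power_mult_distrib power2_eq_square mult_ac)
  thus ?thesis using N by (simp add: field_simps power2_eq_square)
qed

section \<open>Linearity of the policy value\<close>

text \<open>\<open>reward_to_go\<close> and \<open>episode_dist\<close> need not be (sub)probability measures at invalid levels
  and policies, so the measurability premises of the library lemmas on \<open>bind\<close> fail; only the
  values on the support matter.\<close>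
lemma bind_pmf_eq_support:
  assumes sets: "\<And>x. sets (f x) = sets N" and x0: "x0 \<in> set_pmf Q"
  shows "measure_pmf Q \<bind> f = measure_pmf Q \<bind> (\<lambda>x. if x \<in> set_pmf Q then f x else f x0)"
proof -
  let ?g = "\<lambda>x. if x \<in> set_pmf Q then f x else f x0"
  have "emeasure (measure_pmf Q) (f -` B) = emeasure (measure_pmf Q) (?g -` B)" for B
    by (rule emeasure_eq_AE) (auto simp: AE_measure_pmf_iff)
  hence "distr (measure_pmf Q) K f = distr (measure_pmf Q) K ?g" for K
    unfolding distr_def by simp
  \<comment> \<open>\<open>bind\<close> reads its target sigma-algebra off an arbitrary point of the
    space, possibly outside the support; only the measurable sets there matter.\<close>
  moreover have "subprob_algebra (f (SOME x. x \<in> space (measure_pmf Q)))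
      = subprob_algebra (?g (SOME x. x \<in> space (measure_pmf Q)))"
    by (rule subprob_algebra_cong) (auto simp: sets)
  ultimately show ?thesis by (simp add: bind_def)
qed

lemma
  assumes sets: "\<And>x. sets (f x) = sets N" and f: "\<And>x. x \<in> set_pmf Q \<Longrightarrow> prob_space (f x)"
  shows nn_integral_bind_support: "g \<in> borel_measurable N \<Longrightarrow>
      (\<integral>\<^sup>+y. g y \<partial>(measure_pmf Q \<bind> f)) = (\<integral>\<^sup>+x. \<integral>\<^sup>+y. g y \<partial>f x \<partial>measure_pmf Q)"
    and prob_space_bind_support: "prob_space (measure_pmf Q \<bind> f)"
proof -
  obtain x0 where x0: "x0 \<in> set_pmf Q" using set_pmf_not_empty[of Q] by blast
  let ?f = "\<lambda>x. if x \<in> set_pmf Q then f x else f x0"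
  have eq: "measure_pmf Q \<bind> f = measure_pmf Q \<bind> ?f"
    by (rule bind_pmf_eq_support[OF sets x0])
  have m: "?f \<in> measurable (measure_pmf Q) (subprob_algebra N)"
    using f x0 by (auto simp: space_subprob_algebra sets prob_space_imp_subprob_space)
  show int: "(\<integral>\<^sup>+y. g y \<partial>(measure_pmf Q \<bind> f)) = (\<integral>\<^sup>+x. \<integral>\<^sup>+y. g y \<partial>f x \<partial>measure_pmf Q)"
    if "g \<in> borel_measurable N" for g
    unfolding eq nn_integral_bind[OF that m]
    by (intro nn_integral_cong_AE) (auto simp: AE_measure_pmf_iff)
  have "(\<integral>\<^sup>+y. 1 \<partial>(measure_pmf Q \<bind> f)) = (\<integral>\<^sup>+x. \<integral>\<^sup>+y. 1 \<partial>f x \<partial>measure_pmf Q)"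
    by (rule int) auto
  also have "\<dots> = (\<integral>\<^sup>+x. 1 \<partial>measure_pmf Q)"
    by (intro nn_integral_cong_AE) (auto simp: AE_measure_pmf_iff prob_space.emeasure_space_1 f)
  finally show "prob_space (measure_pmf Q \<bind> f)"
    by (intro prob_spaceI) (simp add: measure_pmf.emeasure_space_1)
qed

lemma sets_reward_to_go: "sets (reward_to_go H p R pol n l) = sets borel"
  by (cases n) (auto simp: Let_def)

context
  fixes H k A p R pol
  assumes kernels: "mdp_kernels H k A p R" and pol: "pol \<in> policies H k A"
begin

lemma reward_kernel:
  assumes "l < k" "i < H"
  shows "prob_space (R l i (pol l i))" "sets (R l i (pol l i)) = sets borel"
    "AE x in R l i (pol l i). 0 \<le> x"
  using kernels pol assms by (auto simp: mdp_kernels_def policies_def)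

text \<open>\<open>mdp_kernels\<close> constrains transitions only before the last stage, so the
  last one may lead to a level beyond \<open>k\<close>. It then has \<open>n = 0\<close> stages to
  go and the level is irrelevant.\<close>

lemma transition_support:
  assumes "l < k" "Suc n \<le> H" "s \<in> set_pmf (p (H - Suc n) l (pol l (H - Suc n)))"
  shows "n = 0 \<or> n \<le> H \<and> s < k"
proof (cases "n = 0")
  case False
  have "pol l (H - Suc n) < A" using pol assms by (auto simp: policies_def)
  moreover have "H - Suc n + 1 < H" using assms False by auto
  ultimately have "set_pmf (p (H - Suc n) l (pol l (H - Suc n))) \<subseteq> {..<k}"
    using kernels assms(1) unfolding mdp_kernels_def by blast
  thus ?thesis using assms by auto
qed simp

lemma reward_to_go_prob_space:
  "n = 0 \<or> n \<le> H \<and> l < k \<Longrightarrow> prob_space (reward_to_go H p R pol n l)"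
proof (induction n arbitrary: l)
  case 0
  show ?case by (simp add: prob_space_return)
next
  case (Suc n)
  let ?i = "H - Suc n"
  let ?R = "R l ?i (pol l ?i)" and ?B = "measure_pmf (p ?i l (pol l ?i)) \<bind> reward_to_go H p R pol n"
  have l: "l < k" "Suc n \<le> H" using Suc.prems by auto
  have B: "prob_space ?B"
    by (rule prob_space_bind_support[OF sets_reward_to_go Suc.IH[OF transition_support[OF l]]])
  have sB: "sets ?B = sets borel" by (rule sets_bind) (auto simp: sets_reward_to_go)
  interpret B: prob_space ?B by fact
  interpret RR: prob_space ?R using l by (intro reward_kernel) auto
  interpret P: pair_prob_space ?R ?B ..
  have "sets (?R \<Otimes>\<^sub>M ?B) = sets (borel \<Otimes>\<^sub>M borel)"
    using l by (intro sets_pair_measure_cong sB reward_kernel) auto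
  moreover have "(\<lambda>(x, y). x + y) \<in> borel \<Otimes>\<^sub>M borel \<rightarrow>\<^sub>M (borel :: real measure)"
    by simp
  ultimately have "(\<lambda>(x, y). x + y) \<in> ?R \<Otimes>\<^sub>M ?B \<rightarrow>\<^sub>M (borel :: real measure)"
    using measurable_cong_sets by blast
  thus ?case by (simp add: Let_def convolution_def P.prob_space_distr)
qed

lemma nn_integral_reward_to_go_Suc:
  assumes "Suc n \<le> H" "l < k" and g: "g \<in> borel_measurable borel"
  defines "i \<equiv> H - Suc n"
  shows "(\<integral>\<^sup>+x. g x \<partial>reward_to_go H p R pol (Suc n) l)
    = (\<integral>\<^sup>+x. \<integral>\<^sup>+s. \<integral>\<^sup>+y. g (x + y) \<partial>reward_to_go H p R pol n s \<partial>measure_pmf (p i l (pol l i)) \<partial>R l i (pol l i))"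
proof -
  let ?R = "R l i (pol l i)" and ?B = "measure_pmf (p i l (pol l i)) \<bind> reward_to_go H p R pol n"
  have rtg: "prob_space (reward_to_go H p R pol n s)" if "s \<in> set_pmf (p i l (pol l i))" for s
    using transition_support[of l n s] that assms by (intro reward_to_go_prob_space) auto
  have B: "prob_space ?B"
    by (rule prob_space_bind_support[OF sets_reward_to_go rtg])
  have sB: "sets ?B = sets borel" by (rule sets_bind) (auto simp: sets_reward_to_go)
  have R: "prob_space ?R" "sets ?R = sets borel" using assms by (auto intro!: reward_kernel)
  have "(\<integral>\<^sup>+x. g x \<partial>reward_to_go H p R pol (Suc n) l) = (\<integral>\<^sup>+x. \<integral>\<^sup>+y. g (x + y) \<partial>?B \<partial>?R)"
    using B R sB g
    by (simp add: Let_def i_def[symmetric] nn_integral_convolution prob_space.finite_measure)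
  also have "\<dots> = (\<integral>\<^sup>+x. \<integral>\<^sup>+s. \<integral>\<^sup>+y. g (x + y) \<partial>reward_to_go H p R pol n s \<partial>measure_pmf (p i l (pol l i)) \<partial>?R)"
    using g by (subst nn_integral_bind_support[OF sets_reward_to_go rtg]) auto
  finally show ?thesis .
qed

text \<open>The range [0,1] is assumed for whole episodes only; nonnegativity of partial rewards has
  to come from the steps. It is what allows \<open>ennreal (x + y)\<close> to be split
  below.\<close>

lemma reward_to_go_nonneg:
  "n = 0 \<or> n \<le> H \<and> l < k \<Longrightarrow> AE x in reward_to_go H p R pol n l. 0 \<le> x"
proof (induction n arbitrary: l)
  case 0
  show ?case unfolding reward_to_go.simps by (subst AE_return) auto
next
  case (Suc n)
  let ?i = "H - Suc n"
  have l: "l < k" "Suc n \<le> H" and i: "?i < H" using Suc.prems by auto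
  \<comment> \<open>The mass of the negative half-line is written as an integral so that the
    one-step recursion applies to it.\<close>
  let ?g = "indicator {..<0} :: real \<Rightarrow> ennreal"
  have "(\<integral>\<^sup>+x. ?g x \<partial>reward_to_go H p R pol (Suc n) l)
    = (\<integral>\<^sup>+x. \<integral>\<^sup>+s. \<integral>\<^sup>+y. ?g (x + y) \<partial>reward_to_go H p R pol n s \<partial>measure_pmf (p ?i l (pol l ?i)) \<partial>R l ?i (pol l ?i))"
    using l by (intro nn_integral_reward_to_go_Suc) auto
  also have "\<dots> = (\<integral>\<^sup>+x. 0 \<partial>R l ?i (pol l ?i))"
  proof (rule nn_integral_cong_AE)
    show "AE x in R l ?i (pol l ?i). (\<integral>\<^sup>+s. \<integral>\<^sup>+y. ?g (x + y) \<partial>reward_to_go H p R pol n s \<partial>measure_pmf (p ?i l (pol l ?i))) = 0"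
      using reward_kernel(3)[OF l(1) i]
    proof eventually_elim
      case (elim x)
      have "(\<integral>\<^sup>+y. ?g (x + y) \<partial>reward_to_go H p R pol n s) = (\<integral>\<^sup>+y. 0 \<partial>reward_to_go H p R pol n s)"
        if "s \<in> set_pmf (p ?i l (pol l ?i))" for s
      proof (rule nn_integral_cong_AE)
        show "AE y in reward_to_go H p R pol n s. ?g (x + y) = 0"
          using Suc.IH[OF transition_support[OF l that]] by eventually_elim (use elim in \<open>auto simp: indicator_def\<close>)
      qed
      hence "(\<integral>\<^sup>+s. \<integral>\<^sup>+y. ?g (x + y) \<partial>reward_to_go H p R pol n s \<partial>measure_pmf (p ?i l (pol l ?i)))
          = (\<integral>\<^sup>+s. 0 \<partial>measure_pmf (p ?i l (pol l ?i)))"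
        by (intro nn_integral_cong_AE) (auto simp: AE_measure_pmf_iff)
      thus ?case by simp
    qed
  qed
  finally have "(\<integral>\<^sup>+x. ?g x \<partial>reward_to_go H p R pol (Suc n) l) = 0"
    by (simp del: reward_to_go.simps)
  moreover have "?g \<in> borel_measurable (reward_to_go H p R pol (Suc n) l)"
    unfolding measurable_cong_sets[OF sets_reward_to_go refl] by simp
  ultimately have "AE x in reward_to_go H p R pol (Suc n) l. ?g x = 0"
    using nn_integral_0_iff_AE by blast
  thus ?case by eventually_elim (auto simp: indicator_def split: if_splits)
qed

text \<open>The Bellman equation of a fixed policy, in \<open>ennreal\<close> because an unreachable
  state may have an infinite mean reward. Restricting the sum to levels below \<open>k\<close> is
  harmless at the last stage, where the remaining reward is 0.\<close>

lemma nn_mean_reward_to_go_Suc: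
  assumes "Suc n \<le> H" "l < k"
  defines "i \<equiv> H - Suc n"
  shows "(\<integral>\<^sup>+x. ennreal x \<partial>reward_to_go H p R pol (Suc n) l)
    = (\<integral>\<^sup>+x. ennreal x \<partial>R l i (pol l i)) +
      (\<Sum>s<k. pmf (p i l (pol l i)) s * (\<integral>\<^sup>+x. ennreal x \<partial>reward_to_go H p R pol n s))"
proof -
  let ?G = "\<lambda>s. \<integral>\<^sup>+x. ennreal x \<partial>reward_to_go H p R pol n s"
  have i: "i < H" using assms by simp
  let ?R = "R l i (pol l i)" and ?p = "measure_pmf (p i l (pol l i))"
  have sup: "n = 0 \<or> n \<le> H \<and> s < k" if "s \<in> set_pmf (p i l (pol l i))" for s
    using transition_support[of l n s] that assms by auto
  have "(\<integral>\<^sup>+x. ennreal x \<partial>reward_to_go H p R pol (Suc n) l)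
    = (\<integral>\<^sup>+x. \<integral>\<^sup>+s. \<integral>\<^sup>+y. ennreal (x + y) \<partial>reward_to_go H p R pol n s \<partial>?p \<partial>?R)"
    unfolding i_def using assms by (intro nn_integral_reward_to_go_Suc) auto
  also have "\<dots> = (\<integral>\<^sup>+x. ennreal x + (\<integral>\<^sup>+s. ?G s \<partial>?p) \<partial>?R)"
  proof (rule nn_integral_cong_AE)
    show "AE x in ?R. (\<integral>\<^sup>+s. \<integral>\<^sup>+y. ennreal (x + y) \<partial>reward_to_go H p R pol n s \<partial>?p) = ennreal x + (\<integral>\<^sup>+s. ?G s \<partial>?p)"
      using reward_kernel(3)[OF assms(2) i]
    proof eventually_elim
      case (elim x)
      have "(\<integral>\<^sup>+y. ennreal (x + y) \<partial>reward_to_go H p R pol n s) = ennreal x + ?G s"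
        if "s \<in> set_pmf (p i l (pol l i))" for s
      proof -
        have "(\<integral>\<^sup>+y. ennreal (x + y) \<partial>reward_to_go H p R pol n s)
            = (\<integral>\<^sup>+y. ennreal x + ennreal y \<partial>reward_to_go H p R pol n s)"
          using reward_to_go_nonneg[OF sup[OF that]]
          by (intro nn_integral_cong_AE, eventually_elim) (simp add: elim)
        also have "\<dots> = (\<integral>\<^sup>+y. ennreal x \<partial>reward_to_go H p R pol n s) + ?G s"
          by (intro nn_integral_add) (auto simp: measurable_cong_sets[OF sets_reward_to_go refl])
        finally show ?thesis
          using reward_to_go_prob_space[OF sup[OF that]] by (simp add: prob_space.emeasure_space_1)
      qed
      hence "(\<integral>\<^sup>+s. \<integral>\<^sup>+y. ennreal (x + y) \<partial>reward_to_go H p R pol n s \<partial>?p) = (\<integral>\<^sup>+s. ennreal x + ?G s \<partial>?p)"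
        by (intro nn_integral_cong_AE) (auto simp: AE_measure_pmf_iff)
      also have "\<dots> = ennreal x + (\<integral>\<^sup>+s. ?G s \<partial>?p)"
        by (subst nn_integral_add) (auto simp: measure_pmf.emeasure_space_1)
      finally show ?case .
    qed
  qed
  also have "\<dots> = (\<integral>\<^sup>+x. ennreal x \<partial>?R) + (\<integral>\<^sup>+s. ?G s \<partial>?p)"
    using reward_kernel(1,2)[of l i] assms
    by (subst nn_integral_add) (auto simp: prob_space.emeasure_space_1 cong: measurable_cong_sets)
  also have "(\<integral>\<^sup>+s. ?G s \<partial>?p) = (\<Sum>s<k. pmf (p i l (pol l i)) s * ?G s)"
  proof -
    have "s < k \<or> ?G s = 0" if "s \<in> set_pmf (p i l (pol l i))" for s
      using sup[OF that] by (auto simp: nn_integral_return)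
    hence "(\<integral>\<^sup>+s. ?G s \<partial>?p) = (\<integral>\<^sup>+s. ?G s * indicator {..<k} s \<partial>?p)"
      by (intro nn_integral_cong_AE) (auto simp: AE_measure_pmf_iff indicator_def)
    also have "\<dots> = (\<Sum>s<k. ?G s * emeasure ?p {s})"
      by (subst nn_integral_indicator_finite) auto
    finally show ?thesis by (simp add: emeasure_pmf_single mult.commute)
  qed
  finally show ?thesis .
qed

end

section \<open>Expansion of mean rewards over trajectories\<close>

lemma consistent_insert:
  assumes "finite I" "i \<notin> I"
  shows "consistent (insert i I) (\<sigma>(i := y)) pol = of_bool (pol (fst y) i = snd y) * consistent I \<sigma> pol"
  using assms unfolding consistent_def by (auto intro!: arg_cong2[of _ _ _ _ "(*)"] prod.cong)

lemma sum_trajs_insert: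
  assumes "finite I" "i \<notin> I"
  shows "(\<Sum>\<tau>\<in>trajs (insert i I) k A. f \<tau>) = (\<Sum>y\<in>{..<k} \<times> {..<A}. \<Sum>\<sigma>\<in>trajs I k A. f (\<sigma>(i := y)))"
  unfolding trajs_def PiE_insert_eq
  by (subst sum.reindex[OF inj_combinator[OF assms(2)]]) (simp add: sum.cartesian_product case_prod_unfold)

text \<open>Exactly one trajectory that stays at level 0 is consistent with a given policy. This
  writes the constant 1 in terms of indicators over \<open>I\<close>, so that a reward depending on
  an earlier stage alone can be carried by longer trajectories.\<close>

lemma sum_consistent_level0:
  assumes "finite I" "k \<ge> 1" "\<And>i. i \<in> I \<Longrightarrow> pol 0 i < A"
  shows "(\<Sum>\<sigma>\<in>trajs I k A. of_bool (\<forall>j\<in>I. fst (\<sigma> j) = 0) * consistent I \<sigma> pol) = (1 :: ennreal)"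
  using assms(1,3)
proof (induction I)
  case empty
  show ?case by (simp add: trajs_def consistent_def)
next
  case (insert i I)
  have "(\<Sum>\<sigma>\<in>trajs (insert i I) k A. of_bool (\<forall>j\<in>insert i I. fst (\<sigma> j) = 0) * consistent (insert i I) \<sigma> pol)
     = (\<Sum>y\<in>{..<k} \<times> {..<A}. of_bool (fst y = 0) * of_bool (pol (fst y) i = snd y) *
         (\<Sum>\<sigma>\<in>trajs I k A. of_bool (\<forall>j\<in>I. fst (\<sigma> j) = 0) * consistent I \<sigma> pol) :: ennreal)"
    unfolding sum_trajs_insert[OF insert(1,2)] sum_distrib_left
    using insert(1,2)
    by (intro sum.cong refl) (auto simp: consistent_insert of_bool_def)
  also have "\<dots> = (\<Sum>y\<in>{..<k} \<times> {..<A}. of_bool (y = (0, pol 0 i)))"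
    using insert by (intro sum.cong) (auto simp: of_bool_def)
  also have "\<dots> = 1" using insert.prems assms(2) by (simp add: of_bool_def)
  finally show ?case .
qed

text \<open>Backward induction along the Bellman equation. The coefficients depend on the MDP and
  the starting level but not on the policy, which enters only through the indicators.\<close>

lemma reward_to_go_linear:
  assumes kernels: "mdp_kernels H k A p R" and k: "k \<ge> 1" and "n \<le> H" "l < k"
  shows "\<exists>c. \<forall>pol\<in>policies H k A. (\<integral>\<^sup>+x. ennreal x \<partial>reward_to_go H p R pol n l)
     = (\<Sum>\<sigma>\<in>trajs {H - n..<H} k A. c \<sigma> * consistent {H - n..<H} \<sigma> pol)"
  using assms(3,4)
proof (induction n arbitrary: l)
  case 0
  show ?case by (rule exI[of _ "\<lambda>_. 0"]) (simp add: nn_integral_return)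
next
  case (Suc n)
  define i where "i = H - Suc n"
  define I where "I = {H - n..<H}"
  have I: "{i..<H} = insert i I" "finite I" "i \<notin> I" "i < H" using Suc.prems by (auto simp: i_def I_def)
  let ?G = "\<lambda>pol s. \<integral>\<^sup>+x. ennreal x \<partial>reward_to_go H p R pol n s"
  have "\<forall>s\<in>{..<k}. \<exists>c. \<forall>pol\<in>policies H k A. ?G pol s = (\<Sum>\<sigma>\<in>trajs I k A. c \<sigma> * consistent I \<sigma> pol)"
    using Suc unfolding I_def by auto
  then obtain c where c: "\<And>s pol. s < k \<Longrightarrow> pol \<in> policies H k A \<Longrightarrow>
      ?G pol s = (\<Sum>\<sigma>\<in>trajs I k A. c s \<sigma> * consistent I \<sigma> pol)"
    by (metis lessThan_iff)
  \<comment> \<open>Stage \<open>i\<close> must be at level \<open>l\<close>. Successor coefficients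
    are weighted by the transition probabilities of the action chosen there; the immediate reward
    sits on the tails that stay at level 0, one of which is consistent with any given
    policy.\<close>
  define c' where "c' \<tau> = of_bool (fst (\<tau> i) = l) *
     ((\<integral>\<^sup>+x. ennreal x \<partial>R l i (snd (\<tau> i))) * of_bool (\<forall>j\<in>I. fst (\<tau> j) = 0)
      + (\<Sum>s<k. ennreal (pmf (p i l (snd (\<tau> i))) s) * c s (restrict \<tau> I)))" for \<tau> :: "nat \<Rightarrow> nat \<times> nat"
  show ?case
  proof (intro exI[of _ c'] ballI)
    fix pol assume pol: "pol \<in> policies H k A"
    have polA: "pol l j < A" if "l < k" "j < H" for l j using pol that by (auto simp: policies_def)
    define D where "D a = (\<integral>\<^sup>+x. ennreal x \<partial>R l i a) + (\<Sum>s<k. ennreal (pmf (p i l a) s) * ?G pol s)" for a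
    have inner: "(\<Sum>\<sigma>\<in>trajs I k A. c' (\<sigma>(i := y)) * consistent (insert i I) (\<sigma>(i := y)) pol)
        = of_bool (y = (l, pol l i)) * D (snd y)" for y
    proof -
      let ?a = "snd y"
      have "(\<Sum>\<sigma>\<in>trajs I k A. c' (\<sigma>(i := y)) * consistent (insert i I) (\<sigma>(i := y)) pol)
        = (\<Sum>\<sigma>\<in>trajs I k A. of_bool (y = (l, pol l i)) *
            ((\<integral>\<^sup>+x. ennreal x \<partial>R l i ?a) * (of_bool (\<forall>j\<in>I. fst (\<sigma> j) = 0) * consistent I \<sigma> pol)
             + (\<Sum>s<k. ennreal (pmf (p i l ?a) s) * (c s \<sigma> * consistent I \<sigma> pol))))"
      proof (intro sum.cong refl)
        fix \<sigma> assume "\<sigma> \<in> trajs I k A"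
        hence "restrict (\<sigma>(i := y)) I = \<sigma>"
          using I(3) by (auto simp: trajs_def fun_eq_iff restrict_def PiE_iff extensional_def)
        moreover have "(\<forall>j\<in>I. fst ((\<sigma>(i := y)) j) = 0) = (\<forall>j\<in>I. fst (\<sigma> j) = 0)" using I(3) by auto
        ultimately have c'_eq: "c' (\<sigma>(i := y)) = of_bool (fst y = l) *
           ((\<integral>\<^sup>+x. ennreal x \<partial>R l i ?a) * of_bool (\<forall>j\<in>I. fst (\<sigma> j) = 0)
            + (\<Sum>s<k. ennreal (pmf (p i l ?a) s) * c s \<sigma>))"
          by (simp only: c'_def fun_upd_same)
        show "c' (\<sigma>(i := y)) * consistent (insert i I) (\<sigma>(i := y)) pol
          = of_bool (y = (l, pol l i)) *
            ((\<integral>\<^sup>+x. ennreal x \<partial>R l i ?a) * (of_bool (\<forall>j\<in>I. fst (\<sigma> j) = 0) * consistent I \<sigma> pol)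
             + (\<Sum>s<k. ennreal (pmf (p i l ?a) s) * (c s \<sigma> * consistent I \<sigma> pol)))"
          unfolding consistent_insert[OF I(2,3)] c'_eq
          by (cases "y = (l, pol l i)")
             (simp add: distrib_right sum_distrib_right mult.assoc,
              cases y, auto)
      qed
      also have "\<dots> = of_bool (y = (l, pol l i)) *
          ((\<integral>\<^sup>+x. ennreal x \<partial>R l i ?a) * (\<Sum>\<sigma>\<in>trajs I k A. of_bool (\<forall>j\<in>I. fst (\<sigma> j) = 0) * consistent I \<sigma> pol)
           + (\<Sum>s<k. ennreal (pmf (p i l ?a) s) * (\<Sum>\<sigma>\<in>trajs I k A. c s \<sigma> * consistent I \<sigma> pol)))"
        unfolding sum_distrib_left[symmetric] sum.distrib
        by (subst sum.swap) (simp add: sum_distrib_left)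
      also have "(\<Sum>\<sigma>\<in>trajs I k A. of_bool (\<forall>j\<in>I. fst (\<sigma> j) = 0) * consistent I \<sigma> pol) = (1 :: ennreal)"
        using k polA by (intro sum_consistent_level0[OF I(2) k]) (auto simp: I_def)
      also have "(\<Sum>s<k. ennreal (pmf (p i l ?a) s) * (\<Sum>\<sigma>\<in>trajs I k A. c s \<sigma> * consistent I \<sigma> pol))
          = (\<Sum>s<k. ennreal (pmf (p i l ?a) s) * ?G pol s)"
        using c[OF _ pol] by (intro sum.cong) auto
      finally show ?thesis unfolding D_def mult_1_right .
    qed
    have "(\<Sum>\<tau>\<in>trajs (insert i I) k A. c' \<tau> * consistent (insert i I) \<tau> pol)
        = (\<Sum>y\<in>{..<k} \<times> {..<A}. of_bool (y = (l, pol l i)) * D (snd y))"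
      unfolding sum_trajs_insert[OF I(2,3)] inner ..
    also have "\<dots> = D (pol l i)"
      using Suc.prems polA[of l i] I(4)
      by (subst sum.mono_neutral_cong_right[of _ "{(l, pol l i)}"]) (auto simp: of_bool_def)
    finally show "(\<integral>\<^sup>+x. ennreal x \<partial>reward_to_go H p R pol (Suc n) l)
       = (\<Sum>\<sigma>\<in>trajs {H - Suc n..<H} k A. c' \<sigma> * consistent {H - Suc n..<H} \<sigma> pol)"
      using nn_mean_reward_to_go_Suc[OF kernels pol Suc.prems]
      unfolding i_def[symmetric] I(1) D_def by simp
  qed
qed

lemma
  assumes "episodic_mdp H k A p R" "k \<ge> 1" "pol \<in> policies H k A"
  shows prob_space_episode_dist: "prob_space (episode_dist H p R pol)"
    and sets_episode_dist: "sets (episode_dist H p R pol) = sets borel"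
    and episode_dist_range: "AE x in episode_dist H p R pol. 0 \<le> x \<and> x \<le> 1"
proof -
  have "mdp_kernels H k A p R" using assms(1) by (simp add: episodic_mdp_def)
  thus "prob_space (episode_dist H p R pol)"
    unfolding episode_dist_def using assms by (intro reward_to_go_prob_space) auto
  show "sets (episode_dist H p R pol) = sets borel"
    unfolding episode_dist_def by (rule sets_reward_to_go)
  show "AE x in episode_dist H p R pol. 0 \<le> x \<and> x \<le> 1"
    using assms by (auto simp: episodic_mdp_def)
qed

lemma
  assumes mdp: "episodic_mdp H k A p R" and k: "k \<ge> 1" and pol: "pol \<in> policies H k A"
  shows nn_mean_episode_dist: "(\<integral>\<^sup>+x. ennreal x \<partial>episode_dist H p R pol) = ennreal (policy_value H p R pol)"
    and policy_value_range: "policy_value H p R pol \<in> {0..1}"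
proof -
  interpret prob_space "episode_dist H p R pol" by (rule prob_space_episode_dist[OF assms])
  note r = episode_dist_range[OF assms]
  have m: "(\<lambda>x. x) \<in> borel_measurable (episode_dist H p R pol)"
    using sets_episode_dist[OF assms] by (simp cong: measurable_cong_sets)
  have int: "integrable (episode_dist H p R pol) (\<lambda>x. x)"
    by (rule integrable_const_bound[of _ 1]) (use r m in auto)
  show "(\<integral>\<^sup>+x. ennreal x \<partial>episode_dist H p R pol) = ennreal (policy_value H p R pol)"
    unfolding policy_value_def using r by (intro nn_integral_eq_integral int) auto
  have "policy_value H p R pol \<le> (\<integral>x. 1 \<partial>episode_dist H p R pol)"
    unfolding policy_value_def using r by (intro integral_mono_AE int) auto
  moreover have "policy_value H p R pol \<ge> 0"
    unfolding policy_value_def using r by (intro integral_nonneg_AE) auto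
  ultimately show "policy_value H p R pol \<in> {0..1}" by (simp add: prob_space)
qed

lemma consistent_eq_of_bool:
  "finite I \<Longrightarrow> consistent I \<tau> pol = of_bool (\<forall>i\<in>I. pol (fst (\<tau> i)) i = snd (\<tau> i))"
  unfolding consistent_def by (induction I rule: finite_induct) (auto simp: of_bool_def)

lemma policy_value_linear:
  assumes mdp: "episodic_mdp H k A p R" and k: "k \<ge> 1"
  shows "\<exists>c. \<forall>pol\<in>policies H k A.
    policy_value H p R pol = (\<Sum>\<tau>\<in>trajs {..<H} k A. c \<tau> * consistent {..<H} \<tau> pol)"
proof -
  obtain c where c: "\<And>pol. pol \<in> policies H k A \<Longrightarrow> ennreal (policy_value H p R pol)
      = (\<Sum>\<tau>\<in>trajs {..<H} k A. c \<tau> * consistent {..<H} \<tau> pol)"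
    using reward_to_go_linear[of H k A p R H 0] mdp k nn_mean_episode_dist[OF mdp k]
    by (auto simp: episodic_mdp_def episode_dist_def lessThan_atLeast0)
  \<comment> \<open>An infinite coefficient would give an infinite value to a policy consistent with \<open>\<tau>\<close>.\<close>
  have fin: "c \<tau> < \<top>" if \<tau>: "\<tau> \<in> trajs {..<H} k A" for \<tau>
  proof -
    \<comment> \<open>Follows \<tau> and plays 0 elsewhere; 0 is a valid action because the action
      of \<tau> at that stage is below \<open>A\<close>.\<close>
    define pol where "pol l i = (if i < H \<and> l = fst (\<tau> i) then snd (\<tau> i) else 0)" for l i
    have \<tau>': "fst (\<tau> i) < k" "snd (\<tau> i) < A" if "i < H" for i
      using that \<tau> by (fastforce simp: trajs_def PiE_iff mem_Times_iff)+
    have pol: "pol \<in> policies H k A"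
      using \<tau>' by (auto simp: policies_def pol_def) (metis gr_zeroI not_less_zero)
    have "consistent {..<H} \<tau> pol = (1 :: ennreal)" by (simp add: consistent_def pol_def)
    hence "c \<tau> = c \<tau> * consistent {..<H} \<tau> pol" by simp
    also have "\<dots> \<le> (\<Sum>\<tau>\<in>trajs {..<H} k A. c \<tau> * consistent {..<H} \<tau> pol)"
      using \<tau> by (intro member_le_sum) (auto simp: finite_trajs)
    also have "\<dots> = ennreal (policy_value H p R pol)" using c[OF pol] ..
    finally show ?thesis using ennreal_less_top le_less_trans by blast
  qed
  show ?thesis
  proof (intro exI[of _ "\<lambda>\<tau>. enn2real (c \<tau>)"] ballI)
    fix pol assume pol: "pol \<in> policies H k A"
    have "policy_value H p R pol = enn2real (\<Sum>\<tau>\<in>trajs {..<H} k A. c \<tau> * consistent {..<H} \<tau> pol)"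
      using c[OF pol] policy_value_range[OF mdp k pol] by (metis atLeastAtMost_iff enn2real_ennreal)
    also have "\<dots> = (\<Sum>\<tau>\<in>trajs {..<H} k A. enn2real (c \<tau> * consistent {..<H} \<tau> pol))"
      using fin by (subst enn2real_sum) (auto simp: o_def consistent_eq_of_bool ennreal_mult_less_top of_bool_def)
    also have "\<dots> = (\<Sum>\<tau>\<in>trajs {..<H} k A. enn2real (c \<tau>) * consistent {..<H} \<tau> pol)"
      by (intro sum.cong refl) (simp add: consistent_eq_of_bool of_bool_def)
    finally show "policy_value H p R pol = (\<Sum>\<tau>\<in>trajs {..<H} k A. enn2real (c \<tau>) * consistent {..<H} \<tau> pol)" .
  qed
qed

section \<open>The learner on histories\<close>

definition rounded_pmf :: "real \<Rightarrow> real measure \<Rightarrow> int pmf" where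
  "rounded_pmf \<epsilon> M = Abs_pmf (distr M (count_space UNIV) (\<lambda>r. \<lfloor>r / \<epsilon>\<rfloor>))"

context
  fixes M :: "real measure" and \<epsilon> :: real
  assumes M: "prob_space M" "sets M = sets borel" and range: "AE x in M. 0 \<le> x \<and> x \<le> 1" and \<epsilon>: "\<epsilon> > 0"
begin

lemma floor_measurable: "(\<lambda>r. \<lfloor>r / \<epsilon>\<rfloor>) \<in> M \<rightarrow>\<^sub>M count_space UNIV"
  unfolding measurable_cong_sets[OF M(2) refl] by measurable

lemma measure_rounded_pmf: "measure_pmf (rounded_pmf \<epsilon> M) = distr M (count_space UNIV) (\<lambda>r. \<lfloor>r / \<epsilon>\<rfloor>)"
  unfolding rounded_pmf_def
proof (rule Abs_pmf_inverse, safe)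
  let ?D = "distr M (count_space UNIV) (\<lambda>r. \<lfloor>r / \<epsilon>\<rfloor>)"
  show D: "prob_space ?D" by (rule prob_space.prob_space_distr[OF M(1) floor_measurable])
  interpret D: prob_space ?D by fact
  show "AE x in ?D. measure ?D {x} \<noteq> 0"
    by (subst D.AE_support_countable) (auto intro!: exI[of _ UNIV])
qed auto

lemma set_rounded_pmf: "set_pmf (rounded_pmf \<epsilon> M) \<subseteq> {0..\<lfloor>1 / \<epsilon>\<rfloor>}"
proof -
  have "AE x in measure_pmf (rounded_pmf \<epsilon> M). x \<in> {0..\<lfloor>1 / \<epsilon>\<rfloor>}"
    unfolding measure_rounded_pmf
  proof (subst AE_distr_iff[OF floor_measurable])
    show "AE r in M. \<lfloor>r / \<epsilon>\<rfloor> \<in> {0..\<lfloor>1 / \<epsilon>\<rfloor>}"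
      using range
    proof eventually_elim
      case (elim r)
      hence "0 \<le> r / \<epsilon>" "r / \<epsilon> \<le> 1 / \<epsilon>" using \<epsilon> by (auto intro: divide_right_mono)
      thus ?case by (auto intro: floor_mono)
    qed
  qed simp
  thus ?thesis by (auto simp: AE_measure_pmf_iff)
qed

lemma rounded_pmf_mean:
  "\<bar>\<epsilon> * measure_pmf.expectation (rounded_pmf \<epsilon> M) real_of_int - (\<integral>x. x \<partial>M)\<bar> \<le> \<epsilon>"
proof -
  interpret prob_space M by (rule M)
  have [measurable]: "(\<lambda>r. real_of_int \<lfloor>r / \<epsilon>\<rfloor>) \<in> borel_measurable M" "(\<lambda>r. r) \<in> borel_measurable M"
    unfolding measurable_cong_sets[OF M(2) refl] by measurable
  have dist: "\<bar>\<epsilon> * \<lfloor>r / \<epsilon>\<rfloor> - r\<bar> \<le> \<epsilon>" for r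
  proof -
    have "\<lfloor>r / \<epsilon>\<rfloor> \<le> r / \<epsilon>" "r / \<epsilon> < \<lfloor>r / \<epsilon>\<rfloor> + 1" by linarith+
    hence "\<lfloor>r / \<epsilon>\<rfloor> * \<epsilon> \<le> r" "r < (\<lfloor>r / \<epsilon>\<rfloor> + 1) * \<epsilon>"
      using \<epsilon> by (simp_all only: pos_le_divide_eq pos_divide_less_eq)
    thus ?thesis by (simp add: abs_le_iff algebra_simps)
  qed
  have int: "integrable M (\<lambda>x. x)"
    by (rule integrable_const_bound[of _ 1]) (use range in auto)
  have "AE x in M. norm (\<epsilon> * real_of_int \<lfloor>x / \<epsilon>\<rfloor>) \<le> 1 + \<epsilon>"
    using range
  proof eventually_elim
    case (elim x)
    thus ?case using dist[of x] by (simp add: abs_le_iff)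
  qed
  hence int': "integrable M (\<lambda>r. \<epsilon> * real_of_int \<lfloor>r / \<epsilon>\<rfloor>)"
    by (rule integrable_const_bound) simp
  have "measure_pmf.expectation (rounded_pmf \<epsilon> M) real_of_int = (\<integral>r. \<lfloor>r / \<epsilon>\<rfloor> \<partial>M)"
    unfolding measure_rounded_pmf by (subst integral_distr[OF floor_measurable]) auto
  hence "\<bar>\<epsilon> * measure_pmf.expectation (rounded_pmf \<epsilon> M) real_of_int - (\<integral>x. x \<partial>M)\<bar>
      = \<bar>\<integral>r. \<epsilon> * \<lfloor>r / \<epsilon>\<rfloor> - r \<partial>M\<bar>"
    using int int' by simp
  also have "\<dots> \<le> (\<integral>r. \<bar>\<epsilon> * \<lfloor>r / \<epsilon>\<rfloor> - r\<bar> \<partial>M)" by (rule integral_abs_bound)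
  also have "\<dots> \<le> (\<integral>r. \<epsilon> \<partial>M)"
    using int int' dist by (intro integral_mono) auto
  finally show ?thesis by (simp add: prob_space)
qed

end

text \<open>Newest entry first, as \<open>est\<close> expects. The type of policies is uncountable,
  so policies are coded by naturals through \<iota>; with rounded rewards the list then has a
  countable type.\<close>

primrec obs :: "(policy \<Rightarrow> nat) \<Rightarrow> real \<Rightarrow> (nat \<Rightarrow> policy \<times> real) \<Rightarrow> nat \<Rightarrow> (nat \<times> int) list" where
  "obs \<iota> \<epsilon> h 0 = []"
| "obs \<iota> \<epsilon> h (Suc t) = (\<iota> (fst (h t)), \<lfloor>snd (h t) / \<epsilon>\<rfloor>) # obs \<iota> \<epsilon> h t"

lemma obs_upd: "t \<le> s \<Longrightarrow> obs \<iota> \<epsilon> (h(s := y)) t = obs \<iota> \<epsilon> h t"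
  by (induction t) auto

lemma measurable_obs: "(\<lambda>h. obs \<iota> \<epsilon> h t) \<in> hist_space \<rightarrow>\<^sub>M count_space UNIV"
proof (induction t)
  case (Suc t)
  have h: "(\<lambda>h. h t) \<in> hist_space \<rightarrow>\<^sub>M count_space UNIV \<Otimes>\<^sub>M (borel :: real measure)"
    unfolding hist_space_def by measurable
  have 1: "(\<lambda>h. \<iota> (fst (h t))) \<in> hist_space \<rightarrow>\<^sub>M count_space UNIV"
    using measurable_compose[OF measurable_compose[OF h measurable_fst], of \<iota>] by simp
  have "(\<lambda>r. \<lfloor>r / \<epsilon>\<rfloor>) \<in> (borel :: real measure) \<rightarrow>\<^sub>M count_space UNIV" by measurable
  from measurable_compose[OF measurable_compose[OF h measurable_snd] this]
  have 2: "(\<lambda>h. \<lfloor>snd (h t) / \<epsilon>\<rfloor>) \<in> hist_space \<rightarrow>\<^sub>M count_space UNIV" .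
  show ?case unfolding obs.simps
    by (rule measurable_compose_countable[OF _ 1], rule measurable_compose_countable[OF _ 2],
        rule measurable_compose_countable[OF _ Suc]) simp
qed simp

text \<open>Contains neither \<open>p\<close> nor \<open>R\<close>: the learner is fixed before the
  MDP. \<open>arm\<close> maps every natural to a valid policy, while \<iota> inverts it on
  \<open>X\<close> only.\<close>

locale mdp_learner = exp2 X J \<phi> M0 \<eta> \<gamma> \<epsilon>
  for X :: "nat set" and J :: "'j set" and \<phi> M0 \<eta> \<gamma> \<epsilon> +
  fixes H k A :: nat and \<iota> :: "policy \<Rightarrow> nat" and arm :: "nat \<Rightarrow> policy"
  assumes arm: "\<And>x. arm x \<in> policies H k A" and \<iota>: "\<And>x. x \<in> X \<Longrightarrow> \<iota> (arm x) = x"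
begin

definition learner :: "nat \<Rightarrow> (nat \<Rightarrow> policy \<times> real) \<Rightarrow> policy pmf" where
  "learner t h = map_pmf arm (play (obs \<iota> \<epsilon> h t))"

lemma valid_learner: "valid_learner H k A learner"
  unfolding valid_learner_def
proof safe
  fix t h x assume "x \<in> set_pmf (learner t h)"
  thus "x \<in> policies H k A" using arm by (auto simp: learner_def)
next
  fix t
  have "(\<lambda>L. measure_pmf (map_pmf arm (play L))) \<in> count_space UNIV \<rightarrow>\<^sub>M subprob_algebra (count_space UNIV)"
    by (simp add: space_subprob_algebra measure_pmf.subprob_space_axioms)
  from measurable_compose[OF measurable_obs this]
  show "(\<lambda>h. measure_pmf (learner t h)) \<in> hist_space \<rightarrow>\<^sub>M subprob_algebra (count_space UNIV)"
    by (simp add: learner_def)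
qed

end

section \<open>Coupling of real-valued histories with the discrete run\<close>

locale mdp_learner_run = mdp_learner X J \<phi> M0 \<eta> \<gamma> \<epsilon> H k A \<iota> arm
  for X :: "nat set" and J :: "'j set" and \<phi> M0 \<eta> \<gamma> \<epsilon> H k A \<iota> arm +
  fixes p R
  assumes mdp: "episodic_mdp H k A p R" and k: "k \<ge> 1" and eps_pos: "\<epsilon> > 0"
    and V_span: "\<exists>c. \<forall>x\<in>X. policy_value H p R (arm x) = (\<Sum>j\<in>J. c j * \<phi> j x)"
begin

definition reward_dist :: "nat \<Rightarrow> real measure" where "reward_dist x = episode_dist H p R (arm x)"

lemma reward_dist: "prob_space (reward_dist x)" "sets (reward_dist x) = sets borel"
  "AE r in reward_dist x. 0 \<le> r \<and> r \<le> 1"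
  unfolding reward_dist_def
  by (rule prob_space_episode_dist[OF mdp k arm] sets_episode_dist[OF mdp k arm] episode_dist_range[OF mdp k arm])+

sublocale exp2_run X J \<phi> M0 \<eta> \<gamma> \<epsilon> "\<lambda>x. policy_value H p R (arm x)"
  "\<lambda>x. rounded_pmf \<epsilon> (reward_dist x)" "\<lfloor>1 / \<epsilon>\<rfloor>"
proof unfold_locales
  show "\<exists>c. \<forall>x\<in>X. policy_value H p R (arm x) = (\<Sum>j\<in>J. c j * \<phi> j x)" by (rule V_span)
  show "policy_value H p R (arm x) \<in> {0..1}" for x by (rule policy_value_range[OF mdp k arm])
  show "\<epsilon> * real_of_int \<lfloor>1 / \<epsilon>\<rfloor> \<le> 1"
    using eps_pos of_int_floor_le[of "1 / \<epsilon>"] by (simp only: pos_le_divide_eq mult.commute)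
  show "set_pmf (rounded_pmf \<epsilon> (reward_dist x)) \<subseteq> {0..\<lfloor>1 / \<epsilon>\<rfloor>}" for x
    by (rule set_rounded_pmf[OF reward_dist eps_pos])
  show "\<bar>\<epsilon> * measure_pmf.expectation (rounded_pmf \<epsilon> (reward_dist x)) real_of_int - policy_value H p R (arm x)\<bar> \<le> \<epsilon>" for x
    using rounded_pmf_mean[OF reward_dist eps_pos, of x] by (simp add: policy_value_def reward_dist_def)
qed (rule eps_pos)

text \<open>One episode with the random choice made among coded arms: every code has a genuine
  reward distribution, whereas \<open>episode_dist\<close> may be ill-behaved at an invalid
  policy.\<close>

definition hist_step :: "nat \<Rightarrow> (nat \<Rightarrow> policy \<times> real) \<Rightarrow> (nat \<Rightarrow> policy \<times> real) measure" where
  "hist_step t h = measure_pmf (play (obs \<iota> \<epsilon> h t)) \<bind>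
     (\<lambda>x. distr (reward_dist x) hist_space (\<lambda>r. h(t := (arm x, r))))"

lemma upd_measurable:
  "(\<lambda>(h, r). h(t := (c, r))) \<in> hist_space \<Otimes>\<^sub>M (borel :: real measure) \<rightarrow>\<^sub>M hist_space"
  unfolding hist_space_def case_prod_beta
  by (rule measurable_fun_upd[where J = UNIV]) auto

lemma space_hist_space: "space hist_space = UNIV"
  by (simp add: hist_space_def space_PiM space_pair_measure)

lemma measurable_distr_upd:
  "(\<lambda>h. distr (reward_dist x) hist_space (\<lambda>r. h(t := (arm x, r)))) \<in> hist_space \<rightarrow>\<^sub>M prob_algebra hist_space"
  using reward_dist upd_measurable
  by (intro measurable_distr_prob_space2[where M = borel]) (auto simp: space_prob_algebra)

text \<open>The history enters both through the update and through the observation list. For a fixed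
  list only the update remains; the lists are then glued along the countable-valued map
  \<open>obs\<close>.\<close>

lemma measurable_hist_step: "hist_step t \<in> hist_space \<rightarrow>\<^sub>M prob_algebra hist_space"
proof -
  have "(\<lambda>h. measure_pmf (play L) \<bind> (\<lambda>x. distr (reward_dist x) hist_space (\<lambda>r. h(t := (arm x, r)))))
      \<in> hist_space \<rightarrow>\<^sub>M prob_algebra hist_space" for L
  proof (rule measurable_bind_prob_space2[where N = "count_space UNIV"])
    show "(\<lambda>h. measure_pmf (play L)) \<in> hist_space \<rightarrow>\<^sub>M prob_algebra (count_space UNIV)"
      by (auto simp: space_prob_algebra measure_pmf.prob_space_axioms)
    show "(\<lambda>(h, x). distr (reward_dist x) hist_space (\<lambda>r. h(t := (arm x, r))))
        \<in> hist_space \<Otimes>\<^sub>M count_space UNIV \<rightarrow>\<^sub>M prob_algebra hist_space"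
      unfolding case_prod_beta
      by (rule measurable_compose_countable[where g = snd and
            f = "\<lambda>x y. distr (reward_dist x) hist_space (\<lambda>r. (fst y)(t := (arm x, r)))"])
         (auto intro: measurable_compose[OF measurable_fst measurable_distr_upd])
  qed
  from measurable_compose_countable[OF this measurable_obs[of \<iota> \<epsilon> t]]
  show ?thesis unfolding hist_step_def[abs_def] .
qed

text \<open>Values off the support of the learner are replaced by a good one, which makes the
  integrand a measurable kernel; only then can the bind be pulled back along
  \<open>arm\<close>.\<close>

lemma bind_learner_eq_hist_step:
  "(measure_pmf (learner t h) \<bind> (\<lambda>pol. distr (episode_dist H p R pol) hist_space (\<lambda>r. h(t := (pol, r)))))
    = hist_step t h"
proof -
  let ?f = "\<lambda>pol. distr (episode_dist H p R pol) hist_space (\<lambda>r. h(t := (pol, r)))"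
  let ?Q = "learner t h"
  obtain x0 where x0: "x0 \<in> set_pmf ?Q" using set_pmf_not_empty[of ?Q] by blast
  let ?g = "\<lambda>x. if x \<in> set_pmf ?Q then ?f x else ?f x0"
  have eq: "?f (arm x) = distr (reward_dist x) hist_space (\<lambda>r. h(t := (arm x, r)))" for x
    by (simp add: reward_dist_def)
  have fin: "?f (arm x) \<in> space (subprob_algebra hist_space)" for x
    using measurable_space[OF measurable_distr_upd, of h x t] space_hist_space
    unfolding eq by (simp add: space_prob_algebra space_subprob_algebra prob_space_imp_subprob_space)
  have Q: "set_pmf ?Q \<subseteq> range arm" by (auto simp: learner_def)
  have g: "?g \<in> count_space UNIV \<rightarrow>\<^sub>M subprob_algebra hist_space"
    using fin Q x0 by (auto simp: Pi_iff)
  have "measure_pmf ?Q \<bind> ?f = measure_pmf ?Q \<bind> ?g"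
    by (rule bind_pmf_eq_support[OF _ x0, where N = hist_space]) simp
  also have "\<dots> = measure_pmf (play (obs \<iota> \<epsilon> h t)) \<bind> (\<lambda>x. ?g (arm x))"
    unfolding learner_def map_pmf_rep_eq
    by (rule bind_distr[OF _ g[unfolded learner_def map_pmf_rep_eq]]) auto
  also have "\<dots> = measure_pmf (play (obs \<iota> \<epsilon> h t)) \<bind> (\<lambda>x. ?f (arm x))"
    by (rule bind_measure_pmf_cong[where N = hist_space])
       (use fin Q x0 in \<open>auto simp: learner_def\<close>)
  finally show ?thesis by (simp add: hist_step_def reward_dist_def)
qed

lemma hist_dist_Suc: "hist_dist H p R learner (Suc t) = hist_dist H p R learner t \<bind> hist_step t"
  by (simp add: bind_learner_eq_hist_step cong: bind_cong)

lemma hist_dist_prob: "hist_dist H p R learner t \<in> space (prob_algebra hist_space)"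
proof (induction t)
  case 0
  show ?case by (simp add: space_prob_algebra prob_space_return space_hist_space)
next
  case (Suc t)
  show ?case unfolding hist_dist_Suc
    using measurable_space[OF measurable_bind_prob_space[OF measurable_const[OF Suc] measurable_hist_step],
       of undefined "count_space UNIV"] by simp
qed

lemma distr_hist_step:
  "distr (hist_step t h) (count_space UNIV) (\<lambda>h. obs \<iota> \<epsilon> h (Suc t))
    = measure_pmf (bind_pmf (play (obs \<iota> \<epsilon> h t))
        (\<lambda>x. map_pmf (\<lambda>z. (x, z) # obs \<iota> \<epsilon> h t) (rounded_pmf \<epsilon> (reward_dist x))))"
proof -
  let ?L = "obs \<iota> \<epsilon> h t"
  let ?d = "\<lambda>x. distr (reward_dist x) hist_space (\<lambda>r. h(t := (arm x, r)))"
  have d: "?d x \<in> space (subprob_algebra hist_space)" for x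
    using measurable_space[OF measurable_distr_upd, of h x t] space_hist_space
    by (simp add: space_prob_algebra space_subprob_algebra prob_space_imp_subprob_space)
  have upd: "(\<lambda>r. h(t := (arm x, r))) \<in> reward_dist x \<rightarrow>\<^sub>M hist_space" for x
    using measurable_Pair2[OF upd_measurable, of h t "arm x"] space_hist_space reward_dist(2)
    by (simp cong: measurable_cong_sets)
  have dd: "distr (?d x) (count_space UNIV) (\<lambda>h. obs \<iota> \<epsilon> h (Suc t))
      = distr (reward_dist x) (count_space UNIV) (\<lambda>r. (\<iota> (arm x), \<lfloor>r / \<epsilon>\<rfloor>) # ?L)" for x
    by (subst distr_distr[OF measurable_obs upd]) (simp add: comp_def obs_upd)
  have mm: "measure_pmf (map_pmf (\<lambda>z. (x, z) # ?L) (rounded_pmf \<epsilon> (reward_dist x)))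
      = distr (reward_dist x) (count_space UNIV) (\<lambda>r. (x, \<lfloor>r / \<epsilon>\<rfloor>) # ?L)" for x
    unfolding map_pmf_rep_eq measure_rounded_pmf[OF reward_dist eps_pos]
    by (subst distr_distr[OF _ floor_measurable[OF reward_dist eps_pos]]) (auto simp: comp_def)
  have "distr (hist_step t h) (count_space UNIV) (\<lambda>h. obs \<iota> \<epsilon> h (Suc t))
      = measure_pmf (play ?L) \<bind> (\<lambda>x. distr (?d x) (count_space UNIV) (\<lambda>h. obs \<iota> \<epsilon> h (Suc t)))"
    unfolding hist_step_def using d
    by (intro distr_bind[where K = hist_space] measurable_obs) (auto simp: Pi_iff)
  also have "\<dots> = measure_pmf (play ?L) \<bind>
      (\<lambda>x. measure_pmf (map_pmf (\<lambda>z. (x, z) # ?L) (rounded_pmf \<epsilon> (reward_dist x))))"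
  proof (rule bind_measure_pmf_cong[where N = "count_space UNIV"])
    show "distr (?d x) (count_space UNIV) (\<lambda>h. obs \<iota> \<epsilon> h (Suc t)) \<in> space (subprob_algebra (count_space UNIV))" for x
      using d[of x] by (auto simp: space_subprob_algebra intro!: subprob_space.subprob_space_distr
          simp: measurable_cong_sets[of "?d x" hist_space] measurable_obs[where t = "Suc t", unfolded obs.simps])
    show "measure_pmf (map_pmf (\<lambda>z. (x, z) # ?L) (rounded_pmf \<epsilon> (reward_dist x)))
        \<in> space (subprob_algebra (count_space UNIV))" for x
      by (simp add: space_subprob_algebra measure_pmf.subprob_space_axioms)
    show "distr (?d x) (count_space UNIV) (\<lambda>h. obs \<iota> \<epsilon> h (Suc t))
        = measure_pmf (map_pmf (\<lambda>z. (x, z) # ?L) (rounded_pmf \<epsilon> (reward_dist x)))"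
      if "x \<in> set_pmf (play ?L)" for x
      using that by (simp only: dd mm set_play \<iota>)
  qed
  finally show ?thesis by (simp only: measure_pmf_bind)
qed

text \<open>After projection by \<open>obs\<close>, the law of one more episode depends on the
  history only through its current list, so the projected process is the Markov chain
  \<open>run\<close>.\<close>

lemma distr_hist_dist:
  "distr (hist_dist H p R learner t) (count_space UNIV) (\<lambda>h. obs \<iota> \<epsilon> h t) = measure_pmf (run t)"
proof (induction t)
  case 0
  show ?case by (simp add: distr_return space_hist_space return_pmf.rep_eq)
next
  case (Suc t)
  let ?\<mu> = "hist_dist H p R learner t"
  let ?F = "\<lambda>L. measure_pmf (bind_pmf (play L) (\<lambda>x. map_pmf (\<lambda>z. (x, z) # L) (rounded_pmf \<epsilon> (reward_dist x))))"
  have s: "sets ?\<mu> = sets hist_space" and ne: "space ?\<mu> \<noteq> {}"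
    using hist_dist_prob[of t] by (auto simp: space_prob_algebra dest: prob_space.not_empty)
  have step: "hist_step t \<in> ?\<mu> \<rightarrow>\<^sub>M subprob_algebra hist_space"
    unfolding measurable_cong_sets[OF s refl] by (rule measurable_prob_algebraD[OF measurable_hist_step])
  have obs: "(\<lambda>h. obs \<iota> \<epsilon> h t) \<in> ?\<mu> \<rightarrow>\<^sub>M count_space UNIV"
    unfolding measurable_cong_sets[OF s refl] by (rule measurable_obs)
  have F: "?F \<in> count_space UNIV \<rightarrow>\<^sub>M subprob_algebra (count_space UNIV)"
    by (simp add: space_subprob_algebra measure_pmf.subprob_space_axioms)
  have "distr (hist_dist H p R learner (Suc t)) (count_space UNIV) (\<lambda>h. obs \<iota> \<epsilon> h (Suc t))
      = ?\<mu> \<bind> (\<lambda>h. distr (hist_step t h) (count_space UNIV) (\<lambda>h. obs \<iota> \<epsilon> h (Suc t)))"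
    unfolding hist_dist_Suc by (rule distr_bind[OF step ne measurable_obs])
  also have "\<dots> = ?\<mu> \<bind> (\<lambda>h. ?F (obs \<iota> \<epsilon> h t))" unfolding distr_hist_step ..
  also have "\<dots> = distr ?\<mu> (count_space UNIV) (\<lambda>h. obs \<iota> \<epsilon> h t) \<bind> ?F"
    by (rule bind_distr[OF obs F ne, symmetric])
  also have "\<dots> = measure_pmf (run (Suc t))" by (simp only: Suc run.simps measure_pmf_bind)
  finally show ?case .
qed

lemma expected_value_learner:
  "(\<integral>h. (\<integral>pol. policy_value H p R pol \<partial>measure_pmf (learner t h)) \<partial>hist_dist H p R learner t)
    = measure_pmf.expectation (run t) mean_value"
proof -
  have "(\<integral>pol. policy_value H p R pol \<partial>measure_pmf (learner t h)) = mean_value (obs \<iota> \<epsilon> h t)" for h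
    unfolding learner_def mean_value_def
    by (subst integral_map_pmf, subst integral_measure_pmf[of X]) (auto simp: finX set_play pmf_play)
  moreover have "(\<lambda>h. obs \<iota> \<epsilon> h t) \<in> hist_dist H p R learner t \<rightarrow>\<^sub>M count_space UNIV"
    using measurable_obs hist_dist_prob[of t] by (auto simp: space_prob_algebra cong: measurable_cong_sets)
  ultimately show ?thesis
    unfolding distr_hist_dist[symmetric] by (subst integral_distr) auto
qed

lemma expected_regret_learner:
  assumes X: "policies H k A = arm ` X" and ne: "policies H k A \<noteq> {}"
  shows "expected_regret H k A p R learner T
    \<le> ln (card X) / \<eta> + T * (\<gamma> + 2 * (\<epsilon> / \<eta>) + 2 * \<eta> * card J)"
proof -
  have "Opt H k A p R = Max (policy_value H p R ` policies H k A)"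
    unfolding Opt_def using finite_policies ne by (intro cSup_eq_Max) auto
  also have "\<dots> \<in> policy_value H p R ` policies H k A"
    using finite_policies ne by (intro Max_in) auto
  finally obtain x where "x \<in> X" "Opt H k A p R = policy_value H p R (arm x)" using X by auto
  thus ?thesis using regret_bound[of x T] unfolding expected_regret_def expected_value_learner by simp
qed

end

section \<open>The regret bound\<close>

lemma sum_to_nat_on:
  assumes "countable P"
  shows "(\<Sum>x\<in>to_nat_on P ` P. f (from_nat_into P x)) = (\<Sum>y\<in>P. f y)"
  using assms by (subst sum.reindex) (auto simp: inj_on_to_nat_on)

text \<open>All values lie in [0,1]. This trivial bound settles horizons too short for the
  exploration rate to stay below 1/2.\<close>

lemma expected_regret_le_horizon:
  assumes mdp: "episodic_mdp H k A p R" and "k \<ge> 1" "A \<ge> 1"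
    and alg: "\<And>t h. set_pmf (alg t h) \<subseteq> policies H k A"
  shows "expected_regret H k A p R alg T \<le> T"
proof -
  note range = policy_value_range[OF mdp \<open>k \<ge> 1\<close>]
  have "Opt H k A p R \<le> 1"
    unfolding Opt_def using range policies_nonempty[OF \<open>A \<ge> 1\<close>] by (intro cSUP_least) auto
  moreover have "(\<integral>h. (\<integral>pol. policy_value H p R pol \<partial>measure_pmf (alg t h)) \<partial>hist_dist H p R alg t) \<ge> 0" for t
  proof (rule integral_nonneg_AE, rule AE_I2)
    fix h
    have "0 \<le> policy_value H p R pol" if "pol \<in> set_pmf (alg t h)" for pol
      using range[of pol] alg that by auto
    thus "0 \<le> (\<integral>pol. policy_value H p R pol \<partial>measure_pmf (alg t h))"
      by (intro integral_nonneg_AE) (simp add: AE_measure_pmf_iff)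
  qed
  ultimately have "expected_regret H k A p R alg T \<le> (\<Sum>t<T. 1 - 0)"
    unfolding expected_regret_def by (intro sum_mono diff_mono)
  thus ?thesis by simp
qed

lemma regret_upper_bound:
  fixes H k A T :: nat
  assumes H: "H \<ge> 1" and k: "k \<ge> 1" and A: "A \<ge> 1" and T: "T \<ge> 1"
  shows "\<exists>alg. valid_learner H k A alg \<and> (\<forall>p R. episodic_mdp H k A p R \<longrightarrow>
    expected_regret H k A p R alg T \<le> 6 * real (k * A) ^ H * sqrt (real H * real k * real A * real T))"
proof -
  define P where "P = policies H k A"
  define B where "B = real H * real k * real A"
  define d where "d = real (k * A) ^ H"
  define s where "s = sqrt (B * T)"
  have HkA: "1 \<le> H * k * A" using H k A by simp
  hence B: "B \<ge> 1" unfolding B_def of_nat_mult[symmetric] by linarith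
  have "1 \<le> (k * A) ^ H" using k A by simp
  hence d: "d \<ge> 1" unfolding d_def of_nat_power[symmetric] by linarith
  have BT: "1 * 1 \<le> B * T" using B T by (intro mult_mono) auto
  hence s: "s \<ge> 1" "s * s = B * T" by (auto simp: s_def)
  have ds: "1 * 1 \<le> d * s" using d s by (intro mult_mono) auto
  have Tpos: "real T > 0" using T by simp
  \<comment> \<open>\<open>d * s / T\<close> will be the exploration rate. If it exceeds 1/2 then T
    is below \<open>2 * (d * s)\<close>, and a learner that always plays one fixed policy
    suffices.\<close>
  show ?thesis
  proof (cases "d * s / T \<le> 1 / 2")
    case False
    define alg :: "nat \<Rightarrow> (nat \<Rightarrow> policy \<times> real) \<Rightarrow> policy pmf" where "alg = (\<lambda>t h. return_pmf (\<lambda>_ _. 0))"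
    have alg: "set_pmf (alg t h) \<subseteq> policies H k A" for t h
      using A by (auto simp: alg_def policies_def)
    hence "valid_learner H k A alg"
      by (auto simp: valid_learner_def alg_def space_subprob_algebra measure_pmf.subprob_space_axioms)
    moreover have "T \<le> 6 * (d * s)" using False Tpos ds by (simp add: field_simps)
    moreover have "expected_regret H k A p R alg T \<le> T" if "episodic_mdp H k A p R" for p R
      by (rule expected_regret_le_horizon[OF that k A alg])
    ultimately show ?thesis
      by (intro exI[of _ alg]) (fastforce simp: d_def s_def B_def mult.assoc)
  next
    case True
    \<comment> \<open>Balances the two main terms: both B / \<eta> and T \<eta> d^2 become
      \<open>d * s\<close>.\<close>
    define \<eta> where "\<eta> = s / (T * d)"
    \<comment> \<open>Keeps the rounding bias, 2 \<epsilon> / \<eta> per round, at a total of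
      2.\<close>
    define \<epsilon> where "\<epsilon> = \<eta> / T"
    define arm where "arm = from_nat_into P"
    define X where "X = to_nat_on P ` P"
    define J where "J = trajs {..<H} k A"
    define \<phi> :: "_ \<Rightarrow> _ \<Rightarrow> real" where "\<phi> \<tau> x = consistent {..<H} \<tau> (arm x)" for \<tau> :: "nat \<Rightarrow> nat \<times> nat" and x :: nat
    have finP: "finite P" and neP: "P \<noteq> {}"
      unfolding P_def using finite_policies policies_nonempty[OF A] by auto
    have cP: "countable P" using finP by (rule countable_finite)
    have inj: "inj_on (to_nat_on P) P" using cP by (rule inj_on_to_nat_on)
    have cardX: "card X = card P" unfolding X_def using inj by (rule card_image)
    have armX: "arm ` X = P" using cP by (auto simp: X_def arm_def image_image)
    have \<eta>: "\<eta> > 0" using s d Tpos by (simp add: \<eta>_def)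
    have exploration: "\<eta> * d\<^sup>2 = d * s / T" using d Tpos by (simp add: \<eta>_def power2_eq_square)
    interpret mdp_learner X J \<phi> "d\<^sup>2" \<eta> "\<eta> * d\<^sup>2" \<epsilon> H k A "to_nat_on P" arm
    proof unfold_locales
      show "finite X" "X \<noteq> {}" using finP neP by (auto simp: X_def)
      show "finite J" by (simp add: J_def finite_trajs)
      show "0 < \<eta> * d\<^sup>2" using \<eta> d by simp
      show "\<eta> * d\<^sup>2 \<le> 1 / 2" using True by (simp add: exploration)
      show armP: "arm x \<in> policies H k A" for x
        unfolding arm_def P_def[symmetric] using neP by (rule from_nat_into)
      show "to_nat_on P (arm x) = x" if "x \<in> X" for x
        using that cP by (auto simp: X_def arm_def)
      fix c :: "(nat \<Rightarrow> nat \<times> nat) \<Rightarrow> real" and x assume "x \<in> X"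
      let ?f = "\<lambda>pol. \<Sum>\<tau>\<in>J. c \<tau> * consistent {..<H} \<tau> pol"
      have "(?f (arm x))\<^sup>2 \<le> d\<^sup>2 * ((\<Sum>pol\<in>P. (?f pol)\<^sup>2) / card P)"
        using policy_leverage[OF k A armP, of c] by (simp add: J_def P_def d_def)
      thus "(\<Sum>\<tau>\<in>J. c \<tau> * \<phi> \<tau> x)\<^sup>2 \<le> d\<^sup>2 * ((\<Sum>y\<in>X. (\<Sum>\<tau>\<in>J. c \<tau> * \<phi> \<tau> y)\<^sup>2) / card X)"
        unfolding cardX \<phi>_def unfolding X_def arm_def sum_to_nat_on[OF cP, of "\<lambda>pol. (?f pol)\<^sup>2"] .
    qed (use \<eta> in auto)
    have regret: "expected_regret H k A p R learner T \<le> 6 * (d * s)" if mdp: "episodic_mdp H k A p R" for p R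
    proof -
      interpret mdp_learner_run X J \<phi> "d\<^sup>2" \<eta> "\<eta> * d\<^sup>2" \<epsilon> H k A "to_nat_on P" arm p R
      proof unfold_locales
        show "\<epsilon> > 0" using \<eta> Tpos by (simp add: \<epsilon>_def)
        show "\<exists>c. \<forall>x\<in>X. policy_value H p R (arm x) = (\<Sum>j\<in>J. c j * \<phi> j x)"
          using policy_value_linear[OF mdp k] arm by (auto simp: J_def \<phi>_def)
      qed (use mdp k in auto)
      have "expected_regret H k A p R learner T
        \<le> ln (card X) / \<eta> + T * (\<eta> * d\<^sup>2 + 2 * (\<epsilon> / \<eta>) + 2 * \<eta> * card J)"
        by (rule expected_regret_learner) (use armX neP in \<open>simp_all add: P_def\<close>)
      also have "ln (card X) / \<eta> \<le> B / \<eta>"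
      proof (rule divide_right_mono)
        have "ln (card X) = H * k * ln A"
          using A by (simp add: cardX P_def card_policies ln_realpow power_mult[symmetric] mult.commute)
        \<comment> \<open>The crude estimate ln A \<le> A; this is where the factor \<open>A\<close>
          under the root comes from.\<close>
        also have "\<dots> \<le> H * k * real A" using A less_imp_le[OF ln_less_self[of "real A"]] by (intro mult_left_mono) auto
        finally show "ln (card X) \<le> B" by (simp add: B_def)
      qed (use \<eta> in simp)
      also have "B / \<eta> = d * s"
      proof -
        have "B / \<eta> = (B * T) * d / s" using s d Tpos by (simp add: \<eta>_def)
        also have "\<dots> = d * s" using s by (simp add: s(2)[symmetric])
        finally show ?thesis .
      qed
      also have "T * (\<eta> * d\<^sup>2 + 2 * (\<epsilon> / \<eta>) + 2 * \<eta> * card J) = d * s + 2 + 2 * s"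
      proof -
        have "card J = d" by (simp add: J_def card_trajs d_def)
        moreover have "\<epsilon> / \<eta> = 1 / T" using \<eta> by (simp add: \<epsilon>_def)
        moreover have "\<eta> * d = s / T" using d by (simp add: \<eta>_def)
        ultimately show ?thesis using Tpos by (simp add: exploration distrib_left mult.assoc)
      qed
      \<comment> \<open>As \<open>d\<close> and \<open>s\<close> are at least 1, each of 2 and
        \<open>2 * s\<close> is at most \<open>2 * (d * s)\<close>, which gives the constant
        6.\<close>
      also have "d * s + (d * s + 2 + 2 * s) \<le> 6 * (d * s)"
        using ds mult_right_mono[OF d, of s] s(1) by linarith
      finally show ?thesis by simp
    qed
    show ?thesis
      by (intro exI[of _ learner] conjI valid_learner allI impI)
         (use regret in \<open>simp add: d_def s_def B_def mult.assoc\<close>)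
  qed
qed

theorem theorem1:
  "\<exists>C::real. \<forall>H k A T :: nat. H \<ge> 1 \<and> k \<ge> 1 \<and> A \<ge> 1 \<and> T \<ge> 2 \<longrightarrow>
     (\<exists>alg. valid_learner H k A alg \<and>
        (\<forall>p R. episodic_mdp H k A p R \<longrightarrow>
           expected_regret H k A p R alg T
             \<le> C * real H ^ 2 * (real A * real k) ^ H
                 * sqrt (real H * real k * real A * real T * ln (real T))))"
proof (intro exI[of _ 12] allI impI)
  fix H k A T :: nat
  assume *: "H \<ge> 1 \<and> k \<ge> 1 \<and> A \<ge> 1 \<and> T \<ge> 2"
  let ?BT = "real H * real k * real A * real T" and ?d = "(real A * real k) ^ H"
  \<comment> \<open>For T \<ge> 2 the factor 4 ln T exceeds 1, so the logarithm is inserted under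
    the root at the cost of a factor 2; this turns 6 into 12.\<close>
  have "1 / 2 \<le> ln (2 :: real)" using ln2_ge_two_thirds by simp
  also have "\<dots> \<le> ln T" using * by simp
  finally have "?BT * 1 \<le> ?BT * (4 * ln T)" by (intro mult_left_mono) auto
  hence "sqrt ?BT \<le> sqrt (4 * (?BT * ln T))" by (intro real_sqrt_le_mono) (simp add: mult_ac)
  also have "\<dots> = 2 * sqrt (?BT * ln T)" by (simp add: real_sqrt_mult)
  finally have le: "sqrt ?BT \<le> 2 * sqrt (?BT * ln T)" .
  have "6 * real (k * A) ^ H * sqrt ?BT = 6 * ?d * sqrt ?BT" by (simp add: mult.commute)
  also have "\<dots> \<le> 6 * ?d * (2 * sqrt (?BT * ln T))" using le by (intro mult_left_mono) auto
  also have "\<dots> = 12 * 1 * ?d * sqrt (?BT * ln T)" by simp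
  also have "\<dots> \<le> 12 * real H ^ 2 * ?d * sqrt (?BT * ln T)"
    using * by (intro mult_right_mono mult_left_mono) auto
  finally have bound: "6 * real (k * A) ^ H * sqrt ?BT \<le> 12 * real H ^ 2 * ?d * sqrt (?BT * ln T)" .
  show "\<exists>alg. valid_learner H k A alg \<and> (\<forall>p R. episodic_mdp H k A p R \<longrightarrow>
      expected_regret H k A p R alg T \<le> 12 * real H ^ 2 * ?d * sqrt (?BT * ln (real T)))"
    using regret_upper_bound[of H k A T] * bound by (meson le_trans one_le_numeral order.trans)
qed

end
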